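(* Let $\mathcal{R}$ be a left-linear TRS and $\phi,\psi:\mathcal{R}\to\mathbb{N}$ labeling functions such that $\mathcal{R}_{\phi,0}$ and $\mathcal{R}_{\psi,0}$ commute. Suppose that for all $(k,m)\in\mathbb{N}^2\setminus\{(0,0)\}$: every parallel critical peak between $\mathcal{R}_{\phi,k}$ and $\mathcal{R}_{\psi,m}$ is $(\psi,\phi)$-decreasing (with respect to $k,m$), and every parallel critical peak between $\mathcal{R}_{\psi,m}$ and $\mathcal{R}_{\phi,k}$ is $(\phi,\psi)$-decreasing (with respect to $m,k$). Then $\mathcal{R}$ is confluent.
   Context: A TRS is a set of rules $\ell\to r$ ($\ell\notin\mathcal{V}$, $\mathcal{V}ar(r)\subseteq\mathcal{V}ar(\ell)$); left-linear: no variable repeated in a left-hand side; TRSs $\mathcal{R},\mathcal{S}$ commute if ${}_\mathcal{R}\!\!\leftarrow^*\cdot\to_\mathcal{S}^*\subseteq\to_\mathcal{S}^*\cdot{}_\mathcal{R}\!\!\leftarrow^*$; confluence is self-commutation. Positions: $\epsilon$ root, parallel if neither is a prefix of the other, $\mathcal{P}os_\mathcal{F}(t)$ function-symbol positions. Parallel step: for a set $P$ of pairwise parallel positions of $s$, $s\overset{P}{\Rightarrow}_\mathcal{R}t$ iff for each $p\in P$ there are $\ell\to r\in\mathcal{R}$, $\mu$ with $s|_p=\ell\mu$, $t|_p=r\mu$, and $t=s[t|_p]_{p\in P}$; $\Rightarrow_\mathcal{R}$ if for some $P$; $\Leftarrow$ is the inverse. $\mathcal{V}ar(t,P)=\bigcup_{p\in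 P}\mathcal{V}ar(t|_p)$. Parallel critical peak between $\mathcal{R}$ and $\mathcal{S}$: for a variant $\ell\to r$ of an $\mathcal{S}$-rule, non-empty $P\subseteq\mathcal{P}os_\mathcal{F}(\ell)$ pairwise parallel, variants $\ell_p\to r_p$ ($p\in P$) of $\mathcal{R}$-rules, all pairwise variable-disjoint, $\sigma$ an mgu of $\{\ell_p\approx\ell|_p\}_{p\in P}$, and $\ell_\epsilon\to r_\epsilon$ not a variant of $\ell\to r$ if $P=\{\epsilon\}$: the peak $(\ell\sigma)[r_p\sigma]_{p\in P}\;{}_\mathcal{R}\!\overset{P}{\Leftarrow}\;\ell\sigma\xrightarrow{\epsilon}_\mathcal{S}r\sigma$. A labeling function for $\mathcal{R}$ is a function $\mathcal{R}\to\mathbb{N}$; $\mathcal{R}_{\phi,k}=\{\ell\to r\in\mathcal{R}\mid\phi(\ell\to r)\le k\}$, and $\to_{\phi,k}$, $\Rightarrow_{\phi,k}$ abbreviate $\to_{\mathcal{R}_{\phi,k}}$, $\Rightarrow_{\mathcal{R}_{\phi,k}}$. For labeling functions $\phi,\psi$ (used in either order), $\curlyvee k=\{j\in\mathbb{N}\mid j<k\}$, $\curlyvee km=\curlyvee k\cup\curlyvee m$, and for $K\subseteq\mathbb{N}$, $\leftrightarrow_K$ is the union of ${}_{\phi,j}\!\!\leftarrow$ and $\to_{\psi,j}$ for $j\in K$. A peak $t\;{}_{\phi,k}\!\overset{P}{\Leftarrow}\;s\xrightarrow{\epsilon}_{\psi,m}u$ is $(\psi,\phi)$-decreasing if there exist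 a term $v$ and a set $P'$ of pairwise parallel positions with $t\leftrightarrow^*_{\curlyvee k}\cdot\Rightarrow_{\psi,m}\cdot\leftrightarrow^*_{\curlyvee km} v$, $w\overset{P'}{\Rightarrow}_{\phi,k}v$ and $w\leftrightarrow^*_{\curlyvee m}u$ for some $w$, and $\mathcal{V}ar(v,P')\subseteq\mathcal{V}ar(s,P)$. The notion $(\phi,\psi)$-decreasing for a peak $t\;{}_{\psi,m}\!\overset{P}{\Leftarrow}\;s\xrightarrow{\epsilon}_{\phi,k}u$ is defined identically with the roles of $\phi,\psi$ and of $k,m$ exchanged (so $\leftrightarrow_K$ is then the union of ${}_{\psi,j}\!\!\leftarrow$ and $\to_{\phi,j}$). *)

theory Defs
  imports Main "HOL-Library.Sublist"
begin

section \<open>First-order terms, positions, substitutions\<close>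

datatype ('f, 'v) trm = Var 'v | Fun 'f "('f, 'v) trm list"

type_synonym pos = "nat list"
type_synonym ('f, 'v) rule = "('f, 'v) trm \<times> ('f, 'v) trm"
type_synonym ('f, 'v) subst = "'v \<Rightarrow> ('f, 'v) trm"

text \<open>Application of a substitution.\<close>
fun subst_apply :: "('f, 'v) trm \<Rightarrow> ('f, 'v) subst \<Rightarrow> ('f, 'v) trm" (infixl "\<cdot>" 67) where
  "Var x \<cdot> \<sigma> = \<sigma> x"
| "Fun f ts \<cdot> \<sigma> = Fun f (map (\<lambda>t. t \<cdot> \<sigma>) ts)"

text \<open>p is a position of t.\<close>
fun is_pos :: "('f, 'v) trm \<Rightarrow> pos \<Rightarrow> bool" where
  "is_pos t [] = True"
| "is_pos (Var x) (i # p) = False"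
| "is_pos (Fun f ts) (i # p) = (i < length ts \<and> is_pos (ts ! i) p)"

definition poss :: "('f, 'v) trm \<Rightarrow> pos set" where
  "poss t = {p. is_pos t p}"

text \<open>Subterm at a position t|_p.\<close>
fun subt_at :: "('f, 'v) trm \<Rightarrow> pos \<Rightarrow> ('f, 'v) trm" where
  "subt_at t [] = t"
| "subt_at (Var x) (i # p) = Var x"
| "subt_at (Fun f ts) (i # p) = subt_at (ts ! i) p"

text \<open>Replacement t[u]_p.\<close>
fun replace_at :: "('f, 'v) trm \<Rightarrow> pos \<Rightarrow> ('f, 'v) trm \<Rightarrow> ('f, 'v) trm" where
  "replace_at t [] u = u"
| "replace_at (Var x) (i # p) u = Var x"
| "replace_at (Fun f ts) (i # p) u = Fun f (ts[i := replace_at (ts ! i) p u])"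

definition is_Fun_trm :: "('f, 'v) trm \<Rightarrow> bool" where
  "is_Fun_trm t = (\<exists>f ts. t = Fun f ts)"

text \<open>Function-symbol positions Pos_F(t).\<close>
definition funposs :: "('f, 'v) trm \<Rightarrow> pos set" where
  "funposs t = {p. is_pos t p \<and> is_Fun_trm (subt_at t p)}"

definition vars :: "('f, 'v) trm \<Rightarrow> 'v set" where
  "vars t = {x. \<exists>p. is_pos t p \<and> subt_at t p = Var x}"

definition vars_rule :: "('f, 'v) rule \<Rightarrow> 'v set" where
  "vars_rule \<rho> = vars (fst \<rho>) \<union> vars (snd \<rho>)"

text \<open>Var(t,P) = union of Var(t|_p) for p in P.\<close>
definition vars_at :: "('f, 'v) trm \<Rightarrow> pos set \<Rightarrow> 'v set" where
  "vars_at t P = (\<Union>p\<in>P. vars (subt_at t p))"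

text \<open>Parallel positions.\<close>
definition par_pos :: "pos \<Rightarrow> pos \<Rightarrow> bool" where
  "par_pos p q \<longleftrightarrow> \<not> prefix p q \<and> \<not> prefix q p"

definition pairwise_par :: "pos set \<Rightarrow> bool" where
  "pairwise_par P \<longleftrightarrow> (\<forall>p\<in>P. \<forall>q\<in>P. p \<noteq> q \<longrightarrow> par_pos p q)"

text \<open>Simultaneous replacement s[f p]_{p \<in> P} at a finite set of pairwise parallel
  positions, performed as successive single replacements (the order is irrelevant
  for parallel positions).\<close>
definition par_replace :: "('f, 'v) trm \<Rightarrow> pos set \<Rightarrow> (pos \<Rightarrow> ('f, 'v) trm) \<Rightarrow> ('f, 'v) trm \<Rightarrow> bool" where
  "par_replace s P f t \<longleftrightarrow> (\<exists>ps. set ps = P \<and> t = foldr (\<lambda>p u. replace_at u p (f p)) ps s)"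

section \<open>Term rewriting\<close>

definition trs :: "('f, 'v) rule set \<Rightarrow> bool" where
  "trs R \<longleftrightarrow> (\<forall>(l, r)\<in>R. is_Fun_trm l \<and> vars r \<subseteq> vars l)"

definition linear_trm :: "('f, 'v) trm \<Rightarrow> bool" where
  "linear_trm t \<longleftrightarrow> (\<forall>p q x. is_pos t p \<and> is_pos t q \<and> subt_at t p = Var x \<and> subt_at t q = Var x \<longrightarrow> p = q)"

definition left_linear :: "('f, 'v) rule set \<Rightarrow> bool" where
  "left_linear R \<longleftrightarrow> (\<forall>(l, r)\<in>R. linear_trm l)"

text \<open>Rewrite step s \<rightarrow>_R t.\<close>
definition rstep :: "('f, 'v) rule set \<Rightarrow> (('f, 'v) trm \<times> ('f, 'v) trm) set" where
  "rstep R = {(s, t). \<exists>p l r \<sigma>. (l, r) \<in> R \<and> is_pos s p \<and> subt_at s p = l \<cdot> \<sigma>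
                 \<and> t = replace_at s p (r \<cdot> \<sigma>)}"

text \<open>Parallel step s \<Rightarrow>^P_R t.\<close>
definition par_step_at :: "('f, 'v) rule set \<Rightarrow> pos set \<Rightarrow> ('f, 'v) trm \<Rightarrow> ('f, 'v) trm \<Rightarrow> bool" where
  "par_step_at R P s t \<longleftrightarrow> P \<subseteq> poss s \<and> pairwise_par P
     \<and> (\<forall>p\<in>P. \<exists>l r \<mu>. (l, r) \<in> R \<and> subt_at s p = l \<cdot> \<mu> \<and> subt_at t p = r \<cdot> \<mu>)
     \<and> par_replace s P (subt_at t) t"

definition par_step :: "('f, 'v) rule set \<Rightarrow> (('f, 'v) trm \<times> ('f, 'v) trm) set" where
  "par_step R = {(s, t). \<exists>P. par_step_at R P s t}"

definition commute :: "('f, 'v) rule set \<Rightarrow> ('f, 'v) rule set \<Rightarrow> bool" where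
  "commute R S \<longleftrightarrow> ((rstep R)\<inverse>)\<^sup>* O (rstep S)\<^sup>* \<subseteq> (rstep S)\<^sup>* O ((rstep R)\<inverse>)\<^sup>*"

definition confluent :: "('f, 'v) rule set \<Rightarrow> bool" where
  "confluent R \<longleftrightarrow> commute R R"

section \<open>Unification, variants, parallel critical peaks\<close>

definition unifier :: "('f, 'v) subst \<Rightarrow> (('f, 'v) trm \<times> ('f, 'v) trm) set \<Rightarrow> bool" where
  "unifier \<sigma> E \<longleftrightarrow> (\<forall>(a, b)\<in>E. a \<cdot> \<sigma> = b \<cdot> \<sigma>)"

definition mgu :: "('f, 'v) subst \<Rightarrow> (('f, 'v) trm \<times> ('f, 'v) trm) set \<Rightarrow> bool" where
  "mgu \<sigma> E \<longleftrightarrow> unifier \<sigma> E \<and> (\<forall>\<tau>. unifier \<tau> E \<longrightarrow> (\<exists>\<gamma>. \<forall>x. \<tau> x = \<sigma> x \<cdot> \<gamma>))"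

text \<open>\<rho>' is a variant of \<rho>: obtained by a bijective renaming of variables.\<close>
definition variant :: "('f, 'v) rule \<Rightarrow> ('f, 'v) rule \<Rightarrow> bool" where
  "variant \<rho>' \<rho> \<longleftrightarrow> (\<exists>\<pi>. bij \<pi> \<and> fst \<rho>' = fst \<rho> \<cdot> (Var \<circ> \<pi>) \<and> snd \<rho>' = snd \<rho> \<cdot> (Var \<circ> \<pi>))"

text \<open>Parallel critical peak t \<Leftarrow>^P_R s \<rightarrow>^\<epsilon>_S u between R and S
  (R-rules at the parallel positions P, S-rule at the root).\<close>
definition par_crit_peak ::
  "('f, 'v) rule set \<Rightarrow> ('f, 'v) rule set \<Rightarrow> ('f, 'v) trm \<Rightarrow> pos set \<Rightarrow> ('f, 'v) trm \<Rightarrow> ('f, 'v) trm \<Rightarrow> bool" where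
  "par_crit_peak R S t P s u \<longleftrightarrow>
    (\<exists>l r lr \<sigma>.
       (\<exists>\<rho>\<in>S. variant (l, r) \<rho>)
     \<and> P \<noteq> {} \<and> P \<subseteq> funposs l \<and> pairwise_par P
     \<and> (\<forall>p\<in>P. \<exists>\<rho>\<in>R. variant (lr p) \<rho>)
     \<and> (\<forall>p\<in>P. vars_rule (lr p) \<inter> vars_rule (l, r) = {})
     \<and> (\<forall>p\<in>P. \<forall>q\<in>P. p \<noteq> q \<longrightarrow> vars_rule (lr p) \<inter> vars_rule (lr q) = {})
     \<and> mgu \<sigma> {(fst (lr p), subt_at l p) | p. p \<in> P}
     \<and> (P = {[]} \<longrightarrow> \<not> variant (lr []) (l, r))
     \<and> s = l \<cdot> \<sigma> \<and> u = r \<cdot> \<sigma>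
     \<and> par_replace s P (\<lambda>p. snd (lr p) \<cdot> \<sigma>) t)"

section \<open>Labelings and decreasingness\<close>

definition lab :: "('f, 'v) rule set \<Rightarrow> (('f, 'v) rule \<Rightarrow> nat) \<Rightarrow> nat \<Rightarrow> ('f, 'v) rule set" where
  "lab R \<phi> k = {\<rho> \<in> R. \<phi> \<rho> \<le> k}"

text \<open>\<leftrightarrow>_K for the labeling pair (\<phi>,\<psi>): union of _{\<phi>,j}\<leftarrow> and \<rightarrow>_{\<psi>,j} for j \<in> K.\<close>
definition conv_lab :: "('f, 'v) rule set \<Rightarrow> (('f, 'v) rule \<Rightarrow> nat) \<Rightarrow> (('f, 'v) rule \<Rightarrow> nat)
    \<Rightarrow> nat set \<Rightarrow> (('f, 'v) trm \<times> ('f, 'v) trm) set" where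
  "conv_lab R \<phi> \<psi> K = (\<Union>j\<in>K. (rstep (lab R \<phi> j))\<inverse> \<union> rstep (lab R \<psi> j))"

text \<open>decreasing R \<phi> \<psi> k m t P s u: the peak t \<Leftarrow>^P_{\<phi>,k} s \<rightarrow>^\<epsilon>_{\<psi>,m} u is
  (\<psi>,\<phi>)-decreasing in the sense of the paper.\<close>
definition decreasing :: "('f, 'v) rule set \<Rightarrow> (('f, 'v) rule \<Rightarrow> nat) \<Rightarrow> (('f, 'v) rule \<Rightarrow> nat)
    \<Rightarrow> nat \<Rightarrow> nat \<Rightarrow> ('f, 'v) trm \<Rightarrow> pos set \<Rightarrow> ('f, 'v) trm \<Rightarrow> ('f, 'v) trm \<Rightarrow> bool" where
  "decreasing R \<phi> \<psi> k m t P s u \<longleftrightarrow>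
    (\<exists>v P'.
       (t, v) \<in> (conv_lab R \<phi> \<psi> {j. j < k})\<^sup>* O par_step (lab R \<psi> m)
                 O (conv_lab R \<phi> \<psi> ({j. j < k} \<union> {j. j < m}))\<^sup>*
     \<and> (\<exists>w. par_step_at (lab R \<phi> k) P' w v \<and> (w, u) \<in> (conv_lab R \<phi> \<psi> {j. j < m})\<^sup>*)
     \<and> vars_at v P' \<subseteq> vars_at s P)"

end

theory Submission
  imports Defs
begin

text \<open>
  Left-linearity splits a parallel step from an instance of a left-hand side into overlapping
  redexes and a step inside the substitution. The former give an instance of a parallel critical
  peak; the latter survives in its decreasing diagram because of the variable condition. Hence every
  parallel peak of steps with labels at most \<open>k\<close> for \<open>\<phi>\<close> and at most \<open>m\<close> for \<open>\<psi>\<close> has a decreasing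
  diagram, unless \<open>k = m = 0\<close>.

  Since the relations grow with the label, decreasing diagrams need no multiset measure here: if the
  Church-Rosser property holds for all labels below \<open>n\<close>, conversions with labels below \<open>n\<close> are
  valleys, and modulo such conversions the two steps with label \<open>n\<close> have the diamond property. The
  given commutation for label 0 starts this induction, and every finite rewrite sequence uses
  finitely many rules, so its labels are bounded.
\<close>

section \<open>Decreasing diagrams for increasing families\<close>

lemma relcomp_rtrancl_subset:
  assumes "x \<subseteq> z" "z O y \<subseteq> z"
  shows "x O y\<^sup>* \<subseteq> z"
proof -
  have "(s, u) \<in> z" if "(t, u) \<in> y\<^sup>*" "(s, t) \<in> x" for s t u
    using that by (induction rule: rtrancl_induct) (use assms in blast)+
  then show ?thesis by blast
qed

lemma rtrancl_relcomp_subset: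
  assumes "x \<subseteq> z" "y O z \<subseteq> z"
  shows "y\<^sup>* O x \<subseteq> z"
proof -
  have "x\<inverse> O (y\<inverse>)\<^sup>* \<subseteq> z\<inverse>"
    by (rule relcomp_rtrancl_subset) (use assms in blast)+
  then show ?thesis by (auto simp: rtrancl_converse)
qed

lemma rtrancl_idemp_relcomp [simp]: "r\<^sup>* O r\<^sup>* O s = r\<^sup>* O s"
  by (simp flip: O_assoc)

lemma relcomp_rtrancl_swap:
  assumes "x O y \<subseteq> y O x"
  shows "x O y\<^sup>* \<subseteq> y\<^sup>* O x"
proof (rule relcomp_rtrancl_subset)
  have "y\<^sup>* O x O y \<subseteq> y\<^sup>* O y O x"
    by (rule relcomp_mono[OF subset_refl assms])
  also have "\<dots> \<subseteq> y\<^sup>* O x"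
    by (auto intro: rtrancl_into_rtrancl)
  finally show "(y\<^sup>* O x) O y \<subseteq> y\<^sup>* O x" by (simp add: O_assoc)
qed auto

lemma rtrancl_UN_mono:
  fixes r :: "'i :: linorder \<Rightarrow> 'a rel"
  assumes "mono r"
  shows "(\<Union>n. r n)\<^sup>* = (\<Union>n. (r n)\<^sup>*)"
proof
  have "(s, t) \<in> (\<Union>n. (r n)\<^sup>*)" if "(s, t) \<in> (\<Union>n. r n)\<^sup>*" for s t
    using that
  proof (induction rule: rtrancl_induct)
    case (step y z)
    then obtain n m where "(s, y) \<in> (r n)\<^sup>*" "(y, z) \<in> r m" by blast
    moreover have "r n \<subseteq> r (max n m)" "r m \<subseteq> r (max n m)"
      using assms by (simp_all add: monoD)
    ultimately have "(s, y) \<in> (r (max n m))\<^sup>*" "(y, z) \<in> r (max n m)"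
      using rtrancl_mono by blast+
    then show ?case by (blast intro: rtrancl_into_rtrancl)
  qed simp
  then show "(\<Union>n. r n)\<^sup>* \<subseteq> (\<Union>n. (r n)\<^sup>*)" by (rule subrelI)
  have "(r n)\<^sup>* \<subseteq> (\<Union>n. r n)\<^sup>*" for n by (intro rtrancl_mono) blast
  then show "(\<Union>n. (r n)\<^sup>*) \<subseteq> (\<Union>n. r n)\<^sup>*" by blast
qed

definition church_rosser :: "'a rel \<Rightarrow> 'a rel \<Rightarrow> bool" where
  "church_rosser a b \<longleftrightarrow> (a \<union> b)\<^sup>* \<subseteq> b\<^sup>* O a\<^sup>*"

lemma church_rosser_converse:
  assumes "church_rosser a b"
  shows "church_rosser (b\<inverse>) (a\<inverse>)"
proof -
  have "((a \<union> b)\<^sup>*)\<inverse> \<subseteq> (b\<^sup>* O a\<^sup>*)\<inverse>"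
    using assms unfolding church_rosser_def by blast
  then show ?thesis
    unfolding church_rosser_def
    by (simp add: converse_Un converse_relcomp Un_commute flip: rtrancl_converse)
qed

lemma relcomp_rtrancl_swap_modulo:
  assumes "Id \<subseteq> c" "c O c = c" and right: "c O b \<subseteq> b\<^sup>* O c"
    and peak: "a O c O b \<subseteq> c O b O c O a O c"
  shows "a O b\<^sup>* \<subseteq> b\<^sup>* O c O a O c"
proof -
  have idem: "c O c = c" "c O c O z = c O z" for z
    using \<open>c O c = c\<close> by (simp_all flip: O_assoc)
  define x where "x = c O a O c"
  define y where "y = c O b O c"
  have "x O y = c O (a O c O b) O c"
    unfolding x_def y_def by (simp add: O_assoc idem)
  also have "\<dots> \<subseteq> c O (c O b O c O a O c) O c"
    by (intro relcomp_mono peak subset_refl)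
  also have "\<dots> = y O x"
    unfolding x_def y_def by (simp add: O_assoc idem)
  finally have swap: "x O y\<^sup>* \<subseteq> y\<^sup>* O x"
    by (rule relcomp_rtrancl_swap)
  have "b\<^sup>* O (c O b) O c \<subseteq> b\<^sup>* O (b\<^sup>* O c) O c"
    by (intro relcomp_mono right subset_refl)
  also have "\<dots> = b\<^sup>* O c"
    by (simp add: O_assoc idem)
  finally have "(b\<^sup>* O c) O y \<subseteq> b\<^sup>* O c"
    unfolding y_def by (simp add: O_assoc idem)
  moreover have "Id \<subseteq> b\<^sup>* O c"
    using relcomp_mono[of Id "b\<^sup>*", OF _ \<open>Id \<subseteq> c\<close>] by auto
  ultimately have y_star: "Id O y\<^sup>* \<subseteq> b\<^sup>* O c"
    by (intro relcomp_rtrancl_subset)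
  have "r \<subseteq> c O r O c" for r
    using relcomp_mono[OF \<open>Id \<subseteq> c\<close> relcomp_mono[OF subset_refl \<open>Id \<subseteq> c\<close>], of r] by simp
  then have "a O b\<^sup>* \<subseteq> x O y\<^sup>*"
    unfolding x_def y_def by (intro relcomp_mono rtrancl_mono)
  also note swap
  also have "y\<^sup>* O x \<subseteq> (b\<^sup>* O c) O x"
    using y_star by (intro relcomp_mono) auto
  also have "\<dots> = b\<^sup>* O c O a O c"
    unfolding x_def by (simp add: O_assoc idem)
  finally show ?thesis .
qed

lemma church_rosser_modulo:
  assumes "Id \<subseteq> c" "c O c = c"
    and right: "c O b \<subseteq> b\<^sup>* O c" and left: "a O c \<subseteq> c O a\<^sup>*"
    and peak: "a O c O b \<subseteq> c O b O c O a O c"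
  shows "(a \<union> b)\<^sup>* \<subseteq> b\<^sup>* O c O a\<^sup>*"
proof -
  have idem: "c O c O z = c O z" for z
    using \<open>c O c = c\<close> by (simp flip: O_assoc)
  have "(a O b\<^sup>*) O c O a\<^sup>* \<subseteq> (b\<^sup>* O c O a O c) O c O a\<^sup>*"
    using relcomp_rtrancl_swap_modulo[OF assms(1,2) right peak]
    by (rule relcomp_mono[OF _ subset_refl])
  also have "\<dots> = b\<^sup>* O c O (a O c) O a\<^sup>*"
    by (simp add: O_assoc idem)
  also have "\<dots> \<subseteq> b\<^sup>* O c O (c O a\<^sup>*) O a\<^sup>*"
    by (intro relcomp_mono left subset_refl)
  also have "\<dots> = b\<^sup>* O c O a\<^sup>*"
    by (simp add: O_assoc idem)
  finally have "a O (b\<^sup>* O c O a\<^sup>*) \<subseteq> b\<^sup>* O c O a\<^sup>*"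
    by (simp add: O_assoc)
  moreover have "b O (b\<^sup>* O c O a\<^sup>*) \<subseteq> b\<^sup>* O (b\<^sup>* O c O a\<^sup>*)"
    by (rule relcomp_mono) auto
  moreover have "Id O Id O Id \<subseteq> b\<^sup>* O c O a\<^sup>*"
    using \<open>Id \<subseteq> c\<close> by (intro relcomp_mono) auto
  ultimately have "(a \<union> b)\<^sup>* O Id \<subseteq> b\<^sup>* O c O a\<^sup>*"
    by (intro rtrancl_relcomp_subset) simp_all
  then show ?thesis by simp
qed

lemma church_rosser_iff_commute: "church_rosser a b \<longleftrightarrow> a\<^sup>* O b\<^sup>* \<subseteq> b\<^sup>* O a\<^sup>*"
proof
  have "a\<^sup>* O b\<^sup>* \<subseteq> (a \<union> b)\<^sup>* O (a \<union> b)\<^sup>*"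
    by (intro relcomp_mono rtrancl_mono) auto
  then show "a\<^sup>* O b\<^sup>* \<subseteq> b\<^sup>* O a\<^sup>*" if "church_rosser a b"
    using that unfolding church_rosser_def by simp
next
  assume commute: "a\<^sup>* O b\<^sup>* \<subseteq> b\<^sup>* O a\<^sup>*"
  have "a O b\<^sup>* O a\<^sup>* \<subseteq> (a\<^sup>* O b\<^sup>*) O a\<^sup>*" by auto
  also have "\<dots> \<subseteq> (b\<^sup>* O a\<^sup>*) O a\<^sup>*" by (intro relcomp_mono commute subset_refl)
  also have "\<dots> = b\<^sup>* O a\<^sup>*" by (simp add: O_assoc)
  finally have "(a \<union> b) O b\<^sup>* O a\<^sup>* \<subseteq> b\<^sup>* O a\<^sup>*"
    by (auto intro: converse_rtrancl_into_rtrancl)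
  then have "(a \<union> b)\<^sup>* O Id \<subseteq> b\<^sup>* O a\<^sup>*"
    by (intro rtrancl_relcomp_subset) auto
  then show "church_rosser a b" unfolding church_rosser_def by simp
qed

definition below :: "(nat \<Rightarrow> 'a rel) \<Rightarrow> nat \<Rightarrow> 'a rel" where
  "below r k = (\<Union>j<k. r j)\<^sup>*"

lemma below_0 [simp]: "below r 0 = Id"
  by (simp add: below_def)

lemma below_Suc:
  assumes "mono r"
  shows "below r (Suc k) = (r k)\<^sup>*"
proof -
  have "(\<Union>j<Suc k. r j) = r k"
    using monoD[OF assms] by (fastforce simp: less_Suc_eq_le)
  then show ?thesis by (simp add: below_def)
qed

lemma Id_subset_below: "Id \<subseteq> below r k"
  by (auto simp: below_def)

lemma below_idem [simp]: "below r k O below r k = below r k"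
  by (simp add: below_def)

lemma below_idem_relcomp [simp]: "below r k O below r k O s = below r k O s"
  by (simp flip: O_assoc)

lemma below_mono: "j \<le> k \<Longrightarrow> below r j \<subseteq> below r k"
  unfolding below_def by (intro rtrancl_mono UN_mono) auto

lemma converse_below: "(below r k)\<inverse> = below (\<lambda>j. (r j)\<inverse>) k"
  unfolding below_def by (simp add: rtrancl_converse[symmetric] converse_UNION)

abbreviation conv_below :: "(nat \<Rightarrow> 'a rel) \<Rightarrow> (nat \<Rightarrow> 'a rel) \<Rightarrow> nat \<Rightarrow> 'a rel" where
  "conv_below a b \<equiv> below (\<lambda>j. a j \<union> b j)"

definition decreasing_joins ::
  "(nat \<Rightarrow> 'a rel) \<Rightarrow> (nat \<Rightarrow> 'a rel) \<Rightarrow> nat \<Rightarrow> nat \<Rightarrow> 'a rel" where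
  "decreasing_joins a b k m =
    conv_below a b k O b m O conv_below a b (max k m) O a k O conv_below a b m"

lemma decreasing_joinsI:
  assumes "(t, v) \<in> b m" "(v, u) \<in> a k"
  shows "(t, u) \<in> decreasing_joins a b k m"
proof -
  have "Id O b m O Id O a k O Id \<subseteq> decreasing_joins a b k m"
    unfolding decreasing_joins_def by (intro relcomp_mono Id_subset_below subset_refl)
  then show ?thesis using assms by auto
qed

lemma converse_decreasing_joins:
  "(decreasing_joins a b k m)\<inverse> = decreasing_joins (\<lambda>m. (b m)\<inverse>) (\<lambda>k. (a k)\<inverse>) m k"
  unfolding decreasing_joins_def
  by (simp add: converse_relcomp converse_below converse_Un O_assoc Un_commute max.commute)

definition absorbs :: "(nat \<Rightarrow> 'a rel) \<Rightarrow> (nat \<Rightarrow> 'a rel) \<Rightarrow> nat \<Rightarrow> nat \<Rightarrow> bool" where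
  "absorbs a b k j \<longleftrightarrow> a k O (b j)\<^sup>* \<subseteq> conv_below a b k O a k O conv_below a b j"

lemma absorbs_converse_iff:
  "absorbs (\<lambda>m. (b m)\<inverse>) (\<lambda>k. (a k)\<inverse>) m j \<longleftrightarrow>
    (a j)\<^sup>* O b m \<subseteq> conv_below a b j O b m O conv_below a b m"
proof -
  have "absorbs (\<lambda>m. (b m)\<inverse>) (\<lambda>k. (a k)\<inverse>) m j \<longleftrightarrow>
      ((a j)\<^sup>* O b m)\<inverse> \<subseteq> (conv_below a b j O b m O conv_below a b m)\<inverse>"
    by (simp add: absorbs_def converse_relcomp converse_below converse_Un O_assoc Un_commute
        rtrancl_converse del: converse_mono)
  then show ?thesis by simp
qed

locale decreasing_families =
  fixes a b :: "nat \<Rightarrow> 'a rel"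
  assumes mono_left: "mono a" and mono_right: "mono b"
    and church_rosser_0: "church_rosser (a 0) (b 0)"
    and peak: "(k, m) \<noteq> (0, 0) \<Longrightarrow> a k O b m \<subseteq> decreasing_joins a b k m"
begin

abbreviation (input) conv :: "nat \<Rightarrow> 'a rel" where "conv \<equiv> conv_below a b"

lemma converse_families: "decreasing_families (\<lambda>m. (b m)\<inverse>) (\<lambda>k. (a k)\<inverse>)"
proof
  show "church_rosser ((b 0)\<inverse>) ((a 0)\<inverse>)"
    using church_rosser_0 by (rule church_rosser_converse)
next
  fix m k :: nat
  assume "(m, k) \<noteq> (0, 0)"
  then have "(a k O b m)\<inverse> \<subseteq> (decreasing_joins a b k m)\<inverse>"
    using peak[of k m] by auto
  then show "(b m)\<inverse> O (a k)\<inverse> \<subseteq> decreasing_joins (\<lambda>m. (b m)\<inverse>) (\<lambda>k. (a k)\<inverse>) m k"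
    by (simp only: converse_relcomp converse_decreasing_joins)
qed (use mono_left mono_right in \<open>auto simp: mono_def\<close>)

lemma mono_union: "mono (\<lambda>j. a j \<union> b j)"
  using mono_left mono_right by (fastforce simp: mono_def)

lemma conv_below_subset_valley:
  assumes "\<And>i. i < j \<Longrightarrow> church_rosser (a i) (b i)"
  shows "conv j \<subseteq> below b j O below a j"
proof (cases j)
  case (Suc i)
  then show ?thesis
    using assms[of i] unfolding church_rosser_def
    by (simp add: below_Suc mono_left mono_right mono_union)
qed simp

lemma rtrancl_subset_conv_below: "j < k \<Longrightarrow> (b j)\<^sup>* \<subseteq> conv k"
  unfolding below_def by (rule rtrancl_mono) auto

lemma relcomp_conv_below_subset:
  assumes "\<And>i. i < j \<Longrightarrow> church_rosser (a i) (b i)"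
    and "\<And>i. i < j \<Longrightarrow> absorbs a b k i"
  shows "a k O conv j \<subseteq> conv k O a k O below a j"
  using assms
proof (induction j)
  case 0
  have "Id O a k \<subseteq> conv k O a k"
    by (intro relcomp_mono Id_subset_below subset_refl)
  then show ?case by simp
next
  case (Suc j)
  have "conv (Suc j) \<subseteq> below b (Suc j) O below a (Suc j)"
    using Suc.prems by (intro conv_below_subset_valley) auto
  then have "a k O conv (Suc j) \<subseteq> a k O (b j)\<^sup>* O (a j)\<^sup>*"
    unfolding below_Suc[OF mono_left] below_Suc[OF mono_right]
    by (rule relcomp_mono[OF subset_refl])
  also have "\<dots> = (a k O (b j)\<^sup>*) O (a j)\<^sup>*"
    by (simp add: O_assoc)
  also have "\<dots> \<subseteq> (conv k O a k O conv j) O (a j)\<^sup>*"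
    by (intro relcomp_mono Suc.prems(2)[unfolded absorbs_def]) auto
  also have "\<dots> = conv k O (a k O conv j) O (a j)\<^sup>*"
    by (simp add: O_assoc)
  also have "\<dots> \<subseteq> conv k O (conv k O a k O below a j) O (a j)\<^sup>*"
    by (intro relcomp_mono Suc.IH subset_refl) (use Suc.prems in auto)
  also have "\<dots> \<subseteq> conv k O (conv k O a k O below a (Suc j)) O below a (Suc j)"
    by (intro relcomp_mono below_mono subset_refl) (auto simp: below_Suc mono_left)
  also have "\<dots> = conv k O a k O below a (Suc j)"
    by (simp add: O_assoc)
  finally show ?case .
qed

text \<open>Passing the left step through the forward half of the valley and the right step through the
  backward half lowers the bound on the labels in between by one.\<close>

lemma relcomp_conv_below_relcomp_subset:
  assumes "\<And>i. i < j \<Longrightarrow> church_rosser (a i) (b i)"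
    and "\<And>i. i < j \<Longrightarrow> absorbs a b k i"
    and "\<And>i. i < j \<Longrightarrow> absorbs (\<lambda>m. (b m)\<inverse>) (\<lambda>k. (a k)\<inverse>) m i"
  shows "a k O conv j O b m \<subseteq> conv k O a k O b m O conv m"
  using assms
proof (induction j)
  case 0
  have "Id O a k O b m O Id \<subseteq> conv k O a k O b m O conv m"
    by (intro relcomp_mono Id_subset_below subset_refl)
  then show ?case by simp
next
  case (Suc j)
  have "(a k O conv (Suc j)) O b m \<subseteq> (conv k O a k O (a j)\<^sup>*) O b m"
    using relcomp_conv_below_subset[of "Suc j" k, OF Suc.prems(1,2)] unfolding below_Suc[OF mono_left]
    by (rule relcomp_mono[OF _ subset_refl])
  also have "\<dots> = conv k O a k O (a j)\<^sup>* O b m"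
    by (simp add: O_assoc)
  also have "\<dots> \<subseteq> conv k O a k O conv j O b m O conv m"
    using Suc.prems(3)[of j] unfolding absorbs_converse_iff
    by (intro relcomp_mono[OF subset_refl]) simp
  also have "\<dots> = conv k O (a k O conv j O b m) O conv m"
    by (simp add: O_assoc)
  also have "\<dots> \<subseteq> conv k O (conv k O a k O b m O conv m) O conv m"
    by (intro relcomp_mono Suc.IH subset_refl) (use Suc.prems in auto)
  finally show ?case
    by (simp add: O_assoc)
qed

lemma absorbs_step:
  assumes "j < k"
    and "\<And>i. i < j \<Longrightarrow> church_rosser (a i) (b i)"
    and "\<And>i. i < j \<Longrightarrow> absorbs a b k i"
    and "\<And>i. i < j \<Longrightarrow> absorbs (\<lambda>m. (b m)\<inverse>) (\<lambda>k. (a k)\<inverse>) j i"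
  shows "absorbs a b k j"
  unfolding absorbs_def
proof (rule relcomp_rtrancl_subset)
  have "Id O a k O Id \<subseteq> conv k O a k O conv j"
    by (intro relcomp_mono Id_subset_below subset_refl)
  then show "a k \<subseteq> conv k O a k O conv j" by simp
  have "(conv k O a k O conv j) O b j = conv k O (a k O conv j O b j)"
    by (simp add: O_assoc)
  also have "\<dots> \<subseteq> conv k O (conv k O a k O b j O conv j)"
    using assms by (intro relcomp_mono[OF subset_refl] relcomp_conv_below_relcomp_subset) auto
  also have "\<dots> = conv k O (a k O b j) O conv j"
    by (simp add: O_assoc)
  also have "\<dots> \<subseteq> conv k O decreasing_joins a b k j O conv j"
    by (intro relcomp_mono peak subset_refl) (use \<open>j < k\<close> in auto)
  also have "\<dots> = conv k O b j O conv k O a k O conv j"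
    using \<open>j < k\<close> unfolding decreasing_joins_def by (simp add: O_assoc max_def)
  also have "\<dots> \<subseteq> conv k O conv k O conv k O a k O conv j"
    using rtrancl_subset_conv_below[OF \<open>j < k\<close>] by (intro relcomp_mono subset_refl) auto
  finally show "(conv k O a k O conv j) O b j \<subseteq> conv k O a k O conv j" by simp
qed

end

lemma decreasing_families_absorbs:
  assumes "decreasing_families a b" and "\<And>i. i < j \<Longrightarrow> church_rosser (a i) (b i)" and "j < k"
  shows "absorbs a b k j"
  using assms
proof (induction j arbitrary: a b k rule: less_induct)
  case (less j)
  interpret decreasing_families a b by fact
  show ?case
  proof (rule absorbs_step)
    fix i assume "i < j"
    then show "absorbs a b k i"
      using less by (intro less.IH) auto
    show "absorbs (\<lambda>m. (b m)\<inverse>) (\<lambda>k. (a k)\<inverse>) j i"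
      using less.prems \<open>i < j\<close> by (intro less.IH converse_families church_rosser_converse) auto
  qed (use less.prems in auto)
qed

context decreasing_families
begin

lemma relcomp_conv_below_subset_rtrancl:
  assumes "\<And>i. i < n \<Longrightarrow> church_rosser (a i) (b i)"
  shows "a n O conv n \<subseteq> conv n O (a n)\<^sup>*"
proof -
  have "a n O conv n \<subseteq> conv n O a n O below a n"
    using assms decreasing_families_axioms
    by (intro relcomp_conv_below_subset decreasing_families_absorbs) auto
  also have "\<dots> \<subseteq> conv n O (a n)\<^sup>* O below a (Suc n)"
    by (intro relcomp_mono below_mono subset_refl) auto
  finally show ?thesis by (simp add: below_Suc mono_left)
qed

lemma conv_below_relcomp_subset_rtrancl:
  assumes "\<And>i. i < n \<Longrightarrow> church_rosser (a i) (b i)"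
  shows "conv n O b n \<subseteq> (b n)\<^sup>* O conv n"
proof -
  interpret flipped: decreasing_families "\<lambda>m. (b m)\<inverse>" "\<lambda>k. (a k)\<inverse>"
    by (rule converse_families)
  have "(conv n O b n)\<inverse> = (b n)\<inverse> O flipped.conv n"
    by (simp add: converse_relcomp converse_below converse_Un Un_commute)
  also have "\<dots> \<subseteq> flipped.conv n O ((b n)\<inverse>)\<^sup>*"
    using assms by (intro flipped.relcomp_conv_below_subset_rtrancl church_rosser_converse)
  also have "\<dots> = ((b n)\<^sup>* O conv n)\<inverse>"
    by (simp add: converse_relcomp converse_below converse_Un Un_commute rtrancl_converse)
  finally show ?thesis by simp
qed

lemma church_rosser_step:
  assumes "n > 0" and below: "\<And>i. i < n \<Longrightarrow> church_rosser (a i) (b i)"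
  shows "church_rosser (a n) (b n)"
proof -
  have "(a n \<union> b n)\<^sup>* \<subseteq> (b n)\<^sup>* O conv n O (a n)\<^sup>*"
  proof (rule church_rosser_modulo)
    have "a n O conv n O b n \<subseteq> conv n O a n O b n O conv n"
      using below decreasing_families_axioms converse_families
      by (intro relcomp_conv_below_relcomp_subset decreasing_families_absorbs
          church_rosser_converse) auto
    also have "\<dots> = conv n O (a n O b n) O conv n"
      by (simp add: O_assoc)
    also have "\<dots> \<subseteq> conv n O decreasing_joins a b n n O conv n"
      by (intro relcomp_mono peak subset_refl) (use \<open>n > 0\<close> in auto)
    also have "\<dots> = conv n O b n O conv n O a n O conv n"
      by (simp add: decreasing_joins_def O_assoc)
    finally show "a n O conv n O b n \<subseteq> conv n O b n O conv n O a n O conv n" .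
  qed (use below in \<open>simp_all add: Id_subset_below relcomp_conv_below_subset_rtrancl
        conv_below_relcomp_subset_rtrancl\<close>)
  also have "\<dots> \<subseteq> (b n)\<^sup>* O (below b n O below a n) O (a n)\<^sup>*"
    using below by (intro relcomp_mono conv_below_subset_valley subset_refl)
  also have "\<dots> \<subseteq> (b n)\<^sup>* O (below b (Suc n) O below a (Suc n)) O (a n)\<^sup>*"
    by (intro relcomp_mono below_mono subset_refl) auto
  also have "\<dots> = (b n)\<^sup>* O (a n)\<^sup>*"
    by (simp add: below_Suc mono_left mono_right O_assoc)
  finally show ?thesis unfolding church_rosser_def .
qed

theorem church_rosser: "church_rosser (a n) (b n)"
proof (induction n rule: less_induct)
  case (less n)
  then show ?case
    using church_rosser_0 church_rosser_step[of n] by (cases "n = 0") auto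
qed

end

section \<open>Terms and substitutions\<close>

lemma is_pos_Var [simp]: "is_pos (Var x) p \<longleftrightarrow> p = []"
  by (cases p) auto

lemma vars_Var [simp]: "vars (Var x) = {x}"
  by (simp add: vars_def)

lemma vars_Fun [simp]: "vars (Fun f ts) = (\<Union>t\<in>set ts. vars t)"
proof (intro set_eqI iffI)
  fix x assume "x \<in> vars (Fun f ts)"
  then obtain p where "is_pos (Fun f ts) p" "subt_at (Fun f ts) p = Var x" by (auto simp: vars_def)
  then show "x \<in> (\<Union>t\<in>set ts. vars t)" by (cases p) (auto simp: vars_def)
next
  fix x assume "x \<in> (\<Union>t\<in>set ts. vars t)"
  then obtain i p where "i < length ts" "is_pos (ts ! i) p" "subt_at (ts ! i) p = Var x"
    by (auto simp: vars_def in_set_conv_nth)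
  then have "is_pos (Fun f ts) (i # p) \<and> subt_at (Fun f ts) (i # p) = Var x" by simp
  then show "x \<in> vars (Fun f ts)" unfolding vars_def by blast
qed

lemma finite_vars [simp]: "finite (vars t)"
  by (induction t) auto

lemma subst_cong: "(\<And>x. x \<in> vars t \<Longrightarrow> \<sigma> x = \<tau> x) \<Longrightarrow> t \<cdot> \<sigma> = t \<cdot> \<tau>"
  by (induction t) auto

lemma subst_eqD: "t \<cdot> \<sigma> = t \<cdot> \<tau> \<Longrightarrow> x \<in> vars t \<Longrightarrow> \<sigma> x = \<tau> x"
  by (induction t) auto

lemma subst_Var [simp]: "t \<cdot> Var = t"
  by (induction t) (auto simp: map_idI)

lemma subst_upd_fresh: "x \<notin> vars t \<Longrightarrow> t \<cdot> Var(x := s) = t"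
  using subst_cong[of t "Var(x := s)" Var] by (metis fun_upd_other subst_Var)

lemma subst_subst: "t \<cdot> \<sigma> \<cdot> \<tau> = t \<cdot> (\<lambda>x. \<sigma> x \<cdot> \<tau>)"
  by (induction t) auto

lemma subst_upd_absorb: "\<tau> x = s \<cdot> \<tau> \<Longrightarrow> t \<cdot> Var(x := s) \<cdot> \<tau> = t \<cdot> \<tau>"
  unfolding subst_subst by (rule subst_cong) simp

lemma vars_subst: "vars (t \<cdot> \<sigma>) = (\<Union>x\<in>vars t. vars (\<sigma> x))"
  by (induction t) auto

lemma linear_trm_nth: "linear_trm (Fun f ts) \<Longrightarrow> i < length ts \<Longrightarrow> linear_trm (ts ! i)"
  unfolding linear_trm_def by (metis is_pos.simps(3) list.inject subt_at.simps(3))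

lemma linear_trm_disjoint_vars:
  assumes "linear_trm (Fun f ts)" "i < length ts" "j < length ts"
    and "x \<in> vars (ts ! i)" "x \<in> vars (ts ! j)"
  shows "i = j"
proof -
  obtain p q where "is_pos (ts ! i) p" "subt_at (ts ! i) p = Var x"
    "is_pos (ts ! j) q" "subt_at (ts ! j) q = Var x"
    using assms(4,5) by (auto simp: vars_def)
  then have "i # p = j # q"
    using assms(1-3) unfolding linear_trm_def by (metis is_pos.simps(3) subt_at.simps(3))
  then show ?thesis by simp
qed

lemma subt_at_subst: "is_pos t p \<Longrightarrow> subt_at (t \<cdot> \<sigma>) p = subt_at t p \<cdot> \<sigma>"
  by (induction t p rule: subt_at.induct) auto

lemma is_pos_subst: "is_pos t p \<Longrightarrow> is_pos (t \<cdot> \<sigma>) p"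
  by (induction t p rule: is_pos.induct) auto

lemma vars_subt_at: "is_pos t p \<Longrightarrow> vars (subt_at t p) \<subseteq> vars t"
  by (induction t p rule: subt_at.induct) (auto, metis nth_mem subsetD)

section \<open>Unification\<close>

definition idem_mgu :: "('f, 'v) subst \<Rightarrow> (('f, 'v) trm \<times> ('f, 'v) trm) set \<Rightarrow> bool" where
  "idem_mgu \<sigma> E \<longleftrightarrow> unifier \<sigma> E \<and> (\<forall>\<tau>. unifier \<tau> E \<longrightarrow> (\<forall>x. \<sigma> x \<cdot> \<tau> = \<tau> x))"

lemma mgu_if_idem_mgu: "idem_mgu \<sigma> E \<Longrightarrow> mgu \<sigma> E"
  unfolding idem_mgu_def mgu_def by metis

lemma subst_idem_mgu: "idem_mgu \<sigma> E \<Longrightarrow> unifier \<tau> E \<Longrightarrow> t \<cdot> \<sigma> \<cdot> \<tau> = t \<cdot> \<tau>"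
  unfolding idem_mgu_def subst_subst by (auto intro: subst_cong)

lemma idem_mgu_cong: "(\<And>\<sigma>. unifier \<sigma> E \<longleftrightarrow> unifier \<sigma> E') \<Longrightarrow> idem_mgu \<sigma> E \<longleftrightarrow> idem_mgu \<sigma> E'"
  unfolding idem_mgu_def by simp

lemma unifier_empty [simp]: "unifier \<sigma> {}"
  by (simp add: unifier_def)

lemma unifier_insert [simp]: "unifier \<sigma> (insert (s, t) E) \<longleftrightarrow> s \<cdot> \<sigma> = t \<cdot> \<sigma> \<and> unifier \<sigma> E"
  by (auto simp: unifier_def)

lemma unifier_Fun_Fun:
  assumes "length ss = length ts"
  shows "unifier \<sigma> (insert (Fun f ss, Fun f ts) E) \<longleftrightarrow> unifier \<sigma> (set (zip ss ts) \<union> E)"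
  using assms by (auto simp: unifier_def set_zip list_eq_iff_nth_eq)

definition subst_eqs ::
  "('f, 'v) subst \<Rightarrow> (('f, 'v) trm \<times> ('f, 'v) trm) list \<Rightarrow> (('f, 'v) trm \<times> ('f, 'v) trm) list" where
  "subst_eqs \<sigma> E = map (\<lambda>(s, t). (s \<cdot> \<sigma>, t \<cdot> \<sigma>)) E"

lemma unifier_subst_eqs: "unifier \<tau> (set (subst_eqs \<sigma> E)) \<longleftrightarrow> unifier (\<lambda>x. \<sigma> x \<cdot> \<tau>) (set E)"
  by (auto simp: subst_eqs_def unifier_def subst_subst split: prod.splits)

lemma unifier_subst_eqs_upd:
  "\<tau> x = s \<cdot> \<tau> \<Longrightarrow> unifier \<tau> (set (subst_eqs (Var(x := s)) E)) \<longleftrightarrow> unifier \<tau> (set E)"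
  by (auto simp: subst_eqs_def unifier_def subst_upd_absorb split: prod.splits)

lemma size_subst_vars: "x \<in> vars t \<Longrightarrow> size (\<sigma> x) \<le> size (t \<cdot> \<sigma>)"
proof (induction t)
  case (Fun f ts)
  then obtain t where "t \<in> set ts" "size (\<sigma> x) \<le> size (t \<cdot> \<sigma>)" by auto
  then have "size (\<sigma> x) \<le> size_list size (map (\<lambda>t. t \<cdot> \<sigma>) ts)"
    by (intro size_list_estimation'[of "t \<cdot> \<sigma>"]) auto
  then show ?case by simp
qed simp

lemma occurs_check:
  assumes "x \<in> vars t" "\<sigma> x = t \<cdot> \<sigma>"
  shows "t = Var x"
proof (cases t)
  case (Fun f ts)
  then obtain s where s: "s \<in> set ts" "x \<in> vars s" using assms(1) by auto
  then have "size (\<sigma> x) \<le> size_list size (map (\<lambda>t. t \<cdot> \<sigma>) ts)"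
    by (intro size_list_estimation'[of "s \<cdot> \<sigma>"] size_subst_vars) auto
  then show ?thesis using Fun assms(2) by simp
qed (use assms in auto)

lemma idem_mgu_eliminate:
  assumes x: "x \<notin> vars s" and \<sigma>: "idem_mgu \<sigma> (set (subst_eqs (Var(x := s)) E))"
  shows "idem_mgu (\<lambda>y. (Var(x := s)) y \<cdot> \<sigma>) (insert (Var x, s) (set E))"
  unfolding idem_mgu_def
proof (intro conjI allI impI)
  have "unifier (\<lambda>y. (Var(x := s)) y \<cdot> \<sigma>) (set E)"
    using \<sigma> unfolding idem_mgu_def unifier_subst_eqs by blast
  moreover have "s \<cdot> (\<lambda>y. (Var(x := s)) y \<cdot> \<sigma>) = s \<cdot> \<sigma>"
    using subst_upd_fresh[OF x, of s] by (metis subst_subst)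
  ultimately show "unifier (\<lambda>y. (Var(x := s)) y \<cdot> \<sigma>) (insert (Var x, s) (set E))"
    by simp
next
  fix \<tau> y
  assume "unifier \<tau> (insert (Var x, s) (set E))"
  then have \<tau>: "\<tau> x = s \<cdot> \<tau>" "unifier \<tau> (set (subst_eqs (Var(x := s)) E))"
    by (simp_all add: unifier_subst_eqs_upd)
  have "(Var(x := s)) y \<cdot> \<sigma> \<cdot> \<tau> = (Var(x := s)) y \<cdot> \<tau>"
    by (rule subst_idem_mgu[OF \<sigma> \<tau>(2)])
  then show "(Var(x := s)) y \<cdot> \<sigma> \<cdot> \<tau> = \<tau> y"
    using \<tau>(1) by (auto split: if_splits)
qed

definition eqs_size :: "('f, 'v) subst \<Rightarrow> (('f, 'v) trm \<times> ('f, 'v) trm) list \<Rightarrow> nat" where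
  "eqs_size \<tau> E = (\<Sum>(s, t)\<leftarrow>E. Suc (size (s \<cdot> \<tau>)))"

lemma eqs_size_subst_eqs_upd:
  "\<tau> x = s \<cdot> \<tau> \<Longrightarrow> eqs_size \<tau> (subst_eqs (Var(x := s)) E) = eqs_size \<tau> E"
  by (simp add: eqs_size_def subst_eqs_def comp_def case_prod_unfold subst_upd_absorb)

lemma eqs_size_zip:
  "length ss = length ts \<Longrightarrow> eqs_size \<tau> (zip ss ts) = size_list size (map (\<lambda>s. s \<cdot> \<tau>) ss)"
  by (induction ss ts rule: list_induct2) (auto simp: eqs_size_def)

lemma unification_step:
  fixes E :: "(('f, 'v) trm \<times> ('f, 'v) trm) list"
  assumes "unifier \<tau> (set ((s, t) # E))"
  shows "\<exists>E'. eqs_size \<tau> E' < eqs_size \<tau> ((s, t) # E) \<and> unifier \<tau> (set E')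
    \<and> (\<forall>\<sigma>. idem_mgu \<sigma> (set E') \<longrightarrow> (\<exists>\<theta>. idem_mgu \<theta> (set ((s, t) # E))))"
proof -
  have unif: "s \<cdot> \<tau> = t \<cdot> \<tau>" "unifier \<tau> (set E)" using assms by auto
  have size: "eqs_size \<tau> ((s, t) # E) = Suc (size (s \<cdot> \<tau>)) + eqs_size \<tau> E"
    by (simp add: eqs_size_def)
  have fresh: "x \<notin> vars u" if "\<tau> x = u \<cdot> \<tau>" "Var x \<noteq> u" for x u
    using occurs_check that by metis
  consider (trivial) "s = t"
    | (left) x where "s = Var x" "s \<noteq> t" | (right) x where "t = Var x" "s \<noteq> t"
    | (decompose) f ss ts where "s = Fun f ss" "t = Fun f ts" "length ss = length ts"
    using unif(1) by (cases s; cases t) (auto dest: map_eq_imp_length_eq)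
  then show ?thesis
  proof cases
    case trivial
    then show ?thesis
      using unif(2) size by (intro exI[of _ E]) (auto simp: idem_mgu_def)
  next
    case left
    then show ?thesis
      using idem_mgu_eliminate[OF fresh[of x t], of _ E] unif size
      by (intro exI[of _ "subst_eqs (Var(x := t)) E"])
        (auto simp: unifier_subst_eqs_upd eqs_size_subst_eqs_upd)
  next
    case right
    have "idem_mgu \<theta> (insert (t, s) (set E)) \<longleftrightarrow> idem_mgu \<theta> (set ((s, t) # E))" for \<theta>
      by (intro idem_mgu_cong) auto
    then show ?thesis
      using idem_mgu_eliminate[OF fresh[of x s], of _ E] unif size right
      by (intro exI[of _ "subst_eqs (Var(x := s)) E"])
        (auto simp: unifier_subst_eqs_upd eqs_size_subst_eqs_upd)
  next
    case decompose
    have "unifier \<theta> (set (zip ss ts @ E)) \<longleftrightarrow> unifier \<theta> (set ((s, t) # E))" for \<theta> :: "('f, 'v) subst"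
      using decompose by (simp add: unifier_Fun_Fun del: unifier_insert)
    moreover from this have "idem_mgu \<theta> (set (zip ss ts @ E)) \<longleftrightarrow> idem_mgu \<theta> (set ((s, t) # E))" for \<theta>
      by (rule idem_mgu_cong)
    moreover have "eqs_size \<tau> (zip ss ts @ E) < eqs_size \<tau> ((s, t) # E)"
      using size eqs_size_zip[OF decompose(3), of \<tau>] decompose(1) by (simp add: eqs_size_def)
    ultimately show ?thesis using assms by blast
  qed
qed

lemma ex_idem_mgu_list:
  assumes "unifier \<tau> (set E)"
  shows "\<exists>\<sigma>. idem_mgu \<sigma> (set E)"
  using assms
proof (induction E rule: measure_induct_rule[of "eqs_size \<tau>"])
  case (less E)
  show ?case
  proof (cases E)
    case Nil
    then show ?thesis by (auto simp: idem_mgu_def intro: exI[of _ Var])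
  next
    case (Cons e E')
    obtain s t where "E = (s, t) # E'" using Cons by (cases e) auto
    then show ?thesis using unification_step[of \<tau> s t E'] less by metis
  qed
qed

lemma ex_idem_mgu:
  assumes "finite E" "unifier \<tau> E"
  shows "\<exists>\<sigma>. idem_mgu \<sigma> E"
  using assms ex_idem_mgu_list finite_list by metis

section \<open>Parallel replacement\<close>

function (sequential) par_repl ::
  "('f, 'v) trm \<Rightarrow> pos set \<Rightarrow> (pos \<Rightarrow> ('f, 'v) trm) \<Rightarrow> ('f, 'v) trm" where
  "par_repl (Var x) P g = (if [] \<in> P then g [] else Var x)"
| "par_repl (Fun f ts) P g = (if [] \<in> P then g []
     else Fun f (map (\<lambda>i. par_repl (ts ! i) ((#) i -` P) (\<lambda>p. g (i # p))) [0..<length ts]))"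
  by pat_completeness auto
termination
  by (relation "measure (\<lambda>(t, _). size t)")
    (auto simp: less_Suc_eq_le intro!: size_list_estimation')

lemma par_repl_root [simp]: "[] \<in> P \<Longrightarrow> par_repl s P g = g []"
  by (cases s) auto

lemma par_repl_empty [simp]: "par_repl s {} g = s"
proof (induction s arbitrary: g)
  case (Fun f ts)
  then show ?case by (auto intro: nth_equalityI)
qed simp

lemma par_repl_cong:
  assumes "\<And>p. p \<in> P \<Longrightarrow> g p = g' p"
  shows "par_repl s P g = par_repl s P g'"
  using assms by (induction s P g arbitrary: g' rule: par_repl.induct) auto

lemma pairwise_par_root: "pairwise_par P \<Longrightarrow> [] \<in> P \<Longrightarrow> P = {[]}"
  unfolding pairwise_par_def par_pos_def by force

lemma pairwise_par_vimage_Cons: "pairwise_par P \<Longrightarrow> pairwise_par ((#) i -` P)"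
  unfolding pairwise_par_def par_pos_def by fastforce

lemma pairwise_par_subset: "pairwise_par P \<Longrightarrow> Q \<subseteq> P \<Longrightarrow> pairwise_par Q"
  unfolding pairwise_par_def by blast

lemma replace_at_par_repl:
  "pairwise_par (insert p P) \<Longrightarrow> replace_at (par_repl s P g) p (g p) = par_repl s (insert p P) g"
proof (induction p arbitrary: s P g)
  case (Cons i q)
  have nil: "[] \<notin> P" using pairwise_par_root[OF Cons.prems] by auto
  show ?case
  proof (cases s)
    case (Var x)
    then show ?thesis using nil by simp
  next
    case (Fun f ts)
    have same: "(#) i -` insert (i # q) P = insert q ((#) i -` P)" by auto
    have other: "(#) j -` insert (i # q) P = (#) j -` P" if "j \<noteq> i" for j using that by auto
    have "replace_at (par_repl (ts ! i) ((#) i -` P) (\<lambda>p. g (i # p))) q (g (i # q)) =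
       par_repl (ts ! i) ((#) i -` insert (i # q) P) (\<lambda>p. g (i # p))"
      using Cons.IH[of "(#) i -` P" "ts ! i" "\<lambda>p. g (i # p)"]
        pairwise_par_vimage_Cons[OF Cons.prems, of i]
      unfolding same by simp
    then show ?thesis using nil other unfolding Fun
      by (cases "i < length ts")
        (auto intro!: nth_equalityI simp: nth_list_update simp del: vimage_insert)
  qed
qed simp

lemma foldr_replace_at:
  "pairwise_par (set ps) \<Longrightarrow> foldr (\<lambda>p u. replace_at u p (g p)) ps s = par_repl s (set ps) g"
proof (induction ps)
  case (Cons p ps)
  then have "pairwise_par (set ps)" using pairwise_par_subset by (metis set_subset_Cons)
  then show ?case using Cons replace_at_par_repl[of p "set ps" s g] by simp
qed simp

lemma par_replace_iff:
  assumes "pairwise_par P"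
  shows "par_replace s P g t \<longleftrightarrow> finite P \<and> t = par_repl s P g"
proof
  show "finite P \<and> t = par_repl s P g" if "par_replace s P g t"
    using that assms foldr_replace_at unfolding par_replace_def by blast
  assume t: "finite P \<and> t = par_repl s P g"
  then obtain ps where "set ps = P" using finite_list by blast
  with t assms show "par_replace s P g t"
    unfolding par_replace_def by (intro exI[of _ ps]) (simp add: foldr_replace_at)
qed

lemma par_repl_subst:
  "(\<And>p. p \<in> P \<Longrightarrow> is_pos s p) \<Longrightarrow> par_repl s P g \<cdot> \<sigma> = par_repl (s \<cdot> \<sigma>) P (\<lambda>p. g p \<cdot> \<sigma>)"
proof (induction s P g rule: par_repl.induct)
  case (1 x P g)
  then have "[] \<notin> P \<Longrightarrow> P = {}" by (metis all_not_in_conv is_pos_Var)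
  then show ?case by (cases "[] \<in> P") auto
next
  case (2 f ts P g)
  show ?case
  proof (cases "[] \<in> P")
    case False
    have "par_repl (ts ! i) ((#) i -` P) (\<lambda>p. g (i # p)) \<cdot> \<sigma> =
      par_repl (ts ! i \<cdot> \<sigma>) ((#) i -` P) (\<lambda>p. g (i # p) \<cdot> \<sigma>)" if "i < length ts" for i
      using 2(1)[OF False, of i] 2(2) that by force
    then show ?thesis using False by simp
  qed simp
qed

section \<open>Closure properties of term relations\<close>

definition args_closed :: "('f, 'v) trm rel \<Rightarrow> bool" where
  "args_closed r \<longleftrightarrow> (\<forall>f ss ts. (ss, ts) \<in> listrel r \<longrightarrow> (Fun f ss, Fun f ts) \<in> r)"

definition ctxt_closed :: "('f, 'v) trm rel \<Rightarrow> bool" where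
  "ctxt_closed r \<longleftrightarrow> (\<forall>f ss ts. (ss, ts) \<in> listrel1 r \<longrightarrow> (Fun f ss, Fun f ts) \<in> r)"

definition subst_closed :: "('f, 'v) trm rel \<Rightarrow> bool" where
  "subst_closed r \<longleftrightarrow> (\<forall>s t \<sigma>. (s, t) \<in> r \<longrightarrow> (s \<cdot> \<sigma>, t \<cdot> \<sigma>) \<in> r)"

lemma args_closedD: "args_closed r \<Longrightarrow> (ss, ts) \<in> listrel r \<Longrightarrow> (Fun f ss, Fun f ts) \<in> r"
  unfolding args_closed_def by blast

lemma subst_closedD: "subst_closed r \<Longrightarrow> (s, t) \<in> r \<Longrightarrow> (s \<cdot> \<sigma>, t \<cdot> \<sigma>) \<in> r"
  unfolding subst_closed_def by blast

lemma args_closed_converse: "args_closed r \<Longrightarrow> args_closed (r\<inverse>)"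
  unfolding args_closed_def by (simp add: listrel_iff_nth)

lemma listrel_relcomp_subset: "listrel (r O q) \<subseteq> listrel r O listrel q"
proof (rule subrelI)
  fix xs zs assume "(xs, zs) \<in> listrel (r O q)"
  then show "(xs, zs) \<in> listrel r O listrel q"
    by (induction rule: listrel.induct) (auto intro: listrel.intros)
qed

lemma args_closed_relcomp:
  assumes "args_closed r" "args_closed q"
  shows "args_closed (r O q)"
  using assms listrel_relcomp_subset[of r q] unfolding args_closed_def by blast

lemma ctxt_closed_if_args_closed: "refl r \<Longrightarrow> args_closed r \<Longrightarrow> ctxt_closed r"
  unfolding ctxt_closed_def args_closed_def using listrel1_subset_listrel[of r r] by blast

lemma args_closed_rtrancl:
  assumes "ctxt_closed r"
  shows "args_closed (r\<^sup>*)"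
proof -
  have "(Fun f ss, Fun f ts) \<in> r\<^sup>*" if "(ss, ts) \<in> (listrel1 r)\<^sup>*" for f ss ts
    using that
  proof (induction rule: rtrancl_induct)
    case (step us vs)
    then have "(Fun f us, Fun f vs) \<in> r" using assms unfolding ctxt_closed_def by blast
    with step.IH show ?case by (rule rtrancl_into_rtrancl)
  qed simp
  then show ?thesis
    unfolding args_closed_def listrel_rtrancl_eq_rtrancl_listrel1 by blast
qed

lemma subst_closed_rtrancl:
  assumes "subst_closed r"
  shows "subst_closed (r\<^sup>*)"
proof -
  have "(s \<cdot> \<sigma>, t \<cdot> \<sigma>) \<in> r\<^sup>*" if "(s, t) \<in> r\<^sup>*" for s t \<sigma>
    using that by (induction rule: rtrancl_induct)
      (auto dest: subst_closedD[OF assms] intro: rtrancl_into_rtrancl)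
  then show ?thesis unfolding subst_closed_def by blast
qed

lemma ctxt_closed_Un: "ctxt_closed r \<Longrightarrow> ctxt_closed q \<Longrightarrow> ctxt_closed (r \<union> q)"
  by (fastforce simp: ctxt_closed_def listrel1_def)

lemma args_closed_below:
  assumes "\<And>j. ctxt_closed (r j)"
  shows "args_closed (below r k)"
proof -
  have "ctxt_closed (\<Union>j<k. r j)"
    using assms by (fastforce simp: ctxt_closed_def listrel1_def)
  then show ?thesis unfolding below_def by (rule args_closed_rtrancl)
qed

lemma subst_closed_converse: "subst_closed r \<Longrightarrow> subst_closed (r\<inverse>)"
  unfolding subst_closed_def by blast

lemma subst_closed_Un: "subst_closed r \<Longrightarrow> subst_closed q \<Longrightarrow> subst_closed (r \<union> q)"
  unfolding subst_closed_def by blast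

lemma subst_closed_below:
  assumes "\<And>j. subst_closed (r j)"
  shows "subst_closed (below r k)"
proof -
  have "subst_closed (\<Union>j<k. r j)"
    using assms by (fastforce simp: subst_closed_def)
  then show ?thesis unfolding below_def by (rule subst_closed_rtrancl)
qed

lemma args_closed_decreasing_joins:
  assumes "\<And>j. refl (a j)" "\<And>j. args_closed (a j)" "\<And>j. refl (b j)" "\<And>j. args_closed (b j)"
  shows "args_closed (decreasing_joins a b k m)"
  unfolding decreasing_joins_def
  using assms
  by (intro args_closed_relcomp args_closed_below ctxt_closed_Un ctxt_closed_if_args_closed)

section \<open>Root steps and parallel steps\<close>

inductive_set root_step :: "('f, 'v) rule set \<Rightarrow> ('f, 'v) trm rel" for R where
  root_stepI: "(l, r) \<in> R \<Longrightarrow> (l \<cdot> \<mu>, r \<cdot> \<mu>) \<in> root_step R"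

inductive_set pstep :: "('f, 'v) rule set \<Rightarrow> ('f, 'v) trm rel" for R where
  pstep_Var: "(Var x, Var x) \<in> pstep R"
| pstep_Fun: "(ss, ts) \<in> listrel (pstep R) \<Longrightarrow> (Fun f ss, Fun f ts) \<in> pstep R"
| pstep_root: "(s, t) \<in> root_step R \<Longrightarrow> (s, t) \<in> pstep R"
  monos listrel_mono

lemma root_step_iff: "(s, t) \<in> root_step R \<longleftrightarrow> (\<exists>l r \<mu>. (l, r) \<in> R \<and> s = l \<cdot> \<mu> \<and> t = r \<cdot> \<mu>)"
  by (subst root_step.simps) blast

lemma root_step_mono: "R \<subseteq> S \<Longrightarrow> root_step R \<subseteq> root_step S"
  by (auto elim!: root_step.cases intro: root_stepI)

lemma subst_closed_root_step: "subst_closed (root_step R)"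
  unfolding subst_closed_def by (auto elim!: root_step.cases simp: subst_subst intro: root_stepI)

lemma rstep_iff_root_step:
  "(s, t) \<in> rstep R \<longleftrightarrow>
    (\<exists>p u. is_pos s p \<and> (subt_at s p, u) \<in> root_step R \<and> t = replace_at s p u)"
  unfolding rstep_def root_step_iff by blast

lemma root_step_subset_rstep: "root_step R \<subseteq> rstep R"
  by (auto simp: rstep_iff_root_step intro!: exI[of _ "[]"])

lemma ctxt_closed_rstep: "ctxt_closed (rstep R)"
  unfolding ctxt_closed_def
proof (intro allI impI)
  fix f and ss ts :: "('a, 'b) trm list"
  assume "(ss, ts) \<in> listrel1 (rstep R)"
  then obtain us s t vs where "ss = us @ s # vs" "ts = us @ t # vs" "(s, t) \<in> rstep R"
    by (elim listrel1E) auto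
  then obtain p u where "is_pos s p" "(subt_at s p, u) \<in> root_step R" "t = replace_at s p u"
    by (auto simp: rstep_iff_root_step)
  then show "(Fun f ss, Fun f ts) \<in> rstep R"
    using \<open>ss = _\<close> \<open>ts = _\<close> unfolding rstep_iff_root_step
    by (intro exI[of _ "length us # p"] exI[of _ u]) simp
qed

lemma pstep_subst:
  "(\<And>x. x \<in> vars t \<Longrightarrow> (\<sigma> x, \<tau> x) \<in> pstep R) \<Longrightarrow> (t \<cdot> \<sigma>, t \<cdot> \<tau>) \<in> pstep R"
proof (induction t)
  case (Fun f ts)
  have "(ts ! i \<cdot> \<sigma>, ts ! i \<cdot> \<tau>) \<in> pstep R" if "i < length ts" for i
    using Fun that by (metis UN_I nth_mem vars_Fun)
  then show ?case by (auto intro: pstep_Fun simp: listrel_iff_nth)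
qed simp

lemma pstep_refl [simp]: "(t, t) \<in> pstep R"
  using pstep_subst[of t Var Var R] by (simp add: pstep_Var)

lemma refl_pstep: "refl (pstep R)"
  by (simp add: refl_on_def)

lemma args_closed_pstep: "args_closed (pstep R)"
  unfolding args_closed_def by (blast intro: pstep_Fun)

lemma pstep_mono:
  assumes "R \<subseteq> S"
  shows "pstep R \<subseteq> pstep S"
proof (rule subrelI)
  fix s t assume "(s, t) \<in> pstep R"
  then show "(s, t) \<in> pstep S"
    by (induction rule: pstep.induct)
      (use root_step_mono[OF assms] in \<open>auto intro: pstep.intros simp: listrel_iff_nth\<close>)
qed

lemma subst_closed_pstep: "subst_closed (pstep R)"
proof -
  have "(s \<cdot> \<sigma>, t \<cdot> \<sigma>) \<in> pstep R" if "(s, t) \<in> pstep R" for s t \<sigma>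
    using that
  proof (induction rule: pstep.induct)
    case (pstep_root s t)
    then show ?case by (intro pstep.pstep_root subst_closedD[OF subst_closed_root_step])
  qed (auto intro!: pstep.pstep_Fun simp: listrel_iff_nth)
  then show ?thesis unfolding subst_closed_def by blast
qed

lemma rstep_subset_pstep: "rstep R \<subseteq> pstep R"
proof (rule subrelI)
  fix s t assume "(s, t) \<in> rstep R"
  then obtain p u where "is_pos s p" "(subt_at s p, u) \<in> root_step R" "t = replace_at s p u"
    unfolding rstep_iff_root_step by blast
  then show "(s, t) \<in> pstep R"
  proof (induction p arbitrary: s t)
    case Nil
    then show ?case by (simp add: pstep_root)
  next
    case (Cons i p)
    obtain f ss where s: "s = Fun f ss" using Cons.prems by (cases s) auto
    have "(ss ! i, replace_at (ss ! i) p u) \<in> pstep R" using Cons s by simp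
    then show ?case
      using Cons.prems s by (auto intro!: pstep_Fun simp: listrel_iff_nth nth_list_update)
  qed
qed

lemma pstep_subset_rtrancl_rstep: "pstep R \<subseteq> (rstep R)\<^sup>*"
proof (rule subrelI)
  fix s t assume "(s, t) \<in> pstep R"
  then show "(s, t) \<in> (rstep R)\<^sup>*"
  proof (induction rule: pstep.induct)
    case (pstep_Fun ss ts f)
    then have "(ss, ts) \<in> listrel ((rstep R)\<^sup>*)" by (simp add: listrel_iff_nth)
    then show ?case by (rule args_closedD[OF args_closed_rtrancl[OF ctxt_closed_rstep]])
  qed (use root_step_subset_rstep in auto)
qed

lemma rtrancl_pstep: "(pstep R)\<^sup>* = (rstep R)\<^sup>*"
  using rstep_subset_pstep pstep_subset_rtrancl_rstep by (rule rtrancl_subset)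

definition subst_pstep ::
  "('f, 'v) rule set \<Rightarrow> 'v set \<Rightarrow> ('f, 'v) subst \<Rightarrow> ('f, 'v) subst \<Rightarrow> bool" where
  "subst_pstep R X \<sigma> \<tau> \<longleftrightarrow> (\<forall>x. (\<sigma> x, \<tau> x) \<in> pstep R) \<and> (\<forall>x\<in>X. \<sigma> x = \<tau> x)"

lemma subst_pstep_subset: "subst_pstep R X \<sigma> \<tau> \<Longrightarrow> Y \<subseteq> X \<Longrightarrow> subst_pstep R Y \<sigma> \<tau>"
  unfolding subst_pstep_def by blast

lemma par_step_at_iff:
  "par_step_at R P s t \<longleftrightarrow> finite P \<and> P \<subseteq> poss s \<and> pairwise_par P
     \<and> (\<forall>p\<in>P. (subt_at s p, subt_at t p) \<in> root_step R) \<and> t = par_repl s P (subt_at t)"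
  unfolding par_step_at_def root_step_iff using par_replace_iff[of P s "subt_at t" t] by blast

lemma par_step_at_root: "par_step_at R P s t \<Longrightarrow> [] \<in> P \<Longrightarrow> (s, t) \<in> root_step R"
  unfolding par_step_at_iff by force

lemma par_step_at_Fun:
  assumes "par_step_at R P (Fun f ss) t" "[] \<notin> P"
  shows "\<exists>ts. t = Fun f ts \<and> length ts = length ss
    \<and> (\<forall>i<length ss. par_step_at R ((#) i -` P) (ss ! i) (ts ! i))"
proof -
  have finite: "finite P" and par: "pairwise_par P" and pos: "P \<subseteq> poss (Fun f ss)"
    and step: "\<And>p. p \<in> P \<Longrightarrow> (subt_at (Fun f ss) p, subt_at t p) \<in> root_step R"
    and repl: "t = par_repl (Fun f ss) P (subt_at t)"
    using assms(1) unfolding par_step_at_iff by blast+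
  define ts where
    "ts = map (\<lambda>i. par_repl (ss ! i) ((#) i -` P) (\<lambda>p. subt_at t (i # p))) [0..<length ss]"
  have t: "t = Fun f ts"
    by (subst repl) (simp add: assms(2) ts_def)
  have "par_step_at R ((#) i -` P) (ss ! i) (ts ! i)" if "i < length ss" for i
    unfolding par_step_at_iff
  proof (intro conjI ballI)
    have "ts ! i = par_repl (ss ! i) ((#) i -` P) (\<lambda>p. subt_at t (i # p))"
      using that by (simp add: ts_def)
    then show "ts ! i = par_repl (ss ! i) ((#) i -` P) (subt_at (ts ! i))"
      by (simp add: t)
    show "(subt_at (ss ! i) p, subt_at (ts ! i) p) \<in> root_step R" if "p \<in> (#) i -` P" for p
      using step[of "i # p"] that by (simp add: t)
  qed (use finite par pos in \<open>auto simp: poss_def finite_vimageI pairwise_par_vimage_Cons\<close>)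
  moreover have "length ts = length ss" by (simp add: ts_def)
  ultimately show ?thesis using t by blast
qed

lemma par_step_at_root_subst:
  assumes "par_step_at R P w v" "subst_pstep R (vars_at v P) \<gamma> \<gamma>'" "[] \<in> P"
  shows "(w \<cdot> \<gamma>, v \<cdot> \<gamma>') \<in> pstep R"
proof -
  have "vars v \<subseteq> vars_at v P" using assms(3) unfolding vars_at_def by force
  then have "v \<cdot> \<gamma> = v \<cdot> \<gamma>'" using assms(2) by (intro subst_cong) (auto simp: subst_pstep_def)
  then show ?thesis
    using par_step_at_root[OF assms(1,3)] pstep_root subst_closedD[OF subst_closed_pstep] by metis
qed

text \<open>The variable condition says that the redexes contracted at \<open>P\<close> are instantiated alike by
  \<open>\<gamma>\<close> and \<open>\<gamma>'\<close>, so the step at \<open>P\<close> and the steps inside the substitution are parallel.\<close>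

lemma par_step_at_subst:
  assumes "par_step_at R P w v" "subst_pstep R (vars_at v P) \<gamma> \<gamma>'"
  shows "(w \<cdot> \<gamma>, v \<cdot> \<gamma>') \<in> pstep R"
  using assms
proof (induction w arbitrary: P v)
  case (Var x)
  show ?case
  proof (cases "[] \<in> P")
    case True
    show ?thesis using Var.prems True by (rule par_step_at_root_subst)
  next
    case False
    then have "P = {}" using Var.prems(1) unfolding par_step_at_iff poss_def by auto
    then have "v = Var x" using Var.prems(1) unfolding par_step_at_iff by simp
    then show ?thesis using Var.prems(2) unfolding subst_pstep_def by simp
  qed
next
  case (Fun f ws)
  show ?case
  proof (cases "[] \<in> P")
    case True
    show ?thesis using Fun.prems True by (rule par_step_at_root_subst)
  next
    case False
    then obtain vs where v: "v = Fun f vs" and len: "length vs = length ws"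
      and steps: "\<And>i. i < length ws \<Longrightarrow> par_step_at R ((#) i -` P) (ws ! i) (vs ! i)"
      using par_step_at_Fun[OF Fun.prems(1)] by blast
    have "(ws ! i \<cdot> \<gamma>, vs ! i \<cdot> \<gamma>') \<in> pstep R" if "i < length ws" for i
    proof (rule Fun.IH[OF nth_mem[OF that] steps[OF that]])
      have "vars_at (vs ! i) ((#) i -` P) \<subseteq> vars_at v P"
        unfolding v vars_at_def by force
      with Fun.prems(2) show "subst_pstep R (vars_at (vs ! i) ((#) i -` P)) \<gamma> \<gamma>'"
        by (rule subst_pstep_subset)
    qed
    then show ?thesis unfolding v using len by (auto intro!: pstep_Fun simp: listrel_iff_nth)
  qed
qed

lemma par_step_subset_pstep: "par_step R \<subseteq> pstep R"
  using par_step_at_subst[of R _ _ _ Var Var] by (auto simp: par_step_def subst_pstep_def)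

section \<open>Overlaps and parallel critical peaks\<close>

definition overlaps :: "('f, 'v) rule set \<Rightarrow> ('f, 'v) trm \<Rightarrow> ('f, 'v) subst \<Rightarrow> pos set
    \<Rightarrow> (pos \<Rightarrow> ('f, 'v) trm) \<Rightarrow> bool" where
  "overlaps R l \<tau> P g \<longleftrightarrow> finite P \<and> P \<subseteq> funposs l \<and> pairwise_par P
     \<and> (\<forall>p\<in>P. (subt_at l p \<cdot> \<tau>, g p) \<in> root_step R)"

lemma overlaps_empty: "overlaps R l \<tau> {} g"
  by (simp add: overlaps_def pairwise_par_def)

lemma overlaps_root:
  "(Fun f ls \<cdot> \<tau>, t) \<in> root_step R \<Longrightarrow> overlaps R (Fun f ls) \<tau> {[]} (\<lambda>_. t)"
  by (simp add: overlaps_def pairwise_par_def funposs_def is_Fun_trm_def)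

lemma overlaps_Fun:
  assumes "\<And>i. i < length ls \<Longrightarrow> overlaps R (ls ! i) \<tau> (P i) (g i)"
  shows "overlaps R (Fun f ls) \<tau> (\<Union>i<length ls. (#) i ` P i) (\<lambda>p. g (hd p) (tl p))"
  unfolding overlaps_def
proof (intro conjI)
  show "(\<Union>i<length ls. (#) i ` P i) \<subseteq> funposs (Fun f ls)"
    using assms unfolding overlaps_def funposs_def by fastforce
  show "pairwise_par (\<Union>i<length ls. (#) i ` P i)"
    using assms unfolding overlaps_def pairwise_par_def par_pos_def by fastforce
qed (use assms in \<open>auto simp: overlaps_def\<close>)

lemma linear_trm_glue_subst:
  assumes "linear_trm (Fun f ts)"
  shows "\<exists>\<theta>. (\<forall>i<length ts. \<forall>x\<in>vars (ts ! i). \<theta> x = \<theta>s i x) \<and> (\<forall>x. x \<notin> vars (Fun f ts) \<longrightarrow> \<theta> x = \<tau> x)"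
proof -
  define arg where "arg x = (THE i. i < length ts \<and> x \<in> vars (ts ! i))" for x
  have "arg x = i" if "i < length ts" "x \<in> vars (ts ! i)" for x i
    unfolding arg_def using that linear_trm_disjoint_vars[OF assms] by blast
  then show ?thesis
    by (intro exI[of _ "\<lambda>x. if x \<in> vars (Fun f ts) then \<theta>s (arg x) x else \<tau> x"]) auto
qed

lemma subst_pstep_glue:
  assumes "linear_trm (Fun f ls)"
    and P: "\<And>i. i < length ls \<Longrightarrow> P i \<subseteq> funposs (ls ! i)"
    and steps: "\<And>i. i < length ls \<Longrightarrow> subst_pstep R (vars_at (ls ! i) (P i)) \<tau> (\<tau>s i)"
  shows "\<exists>\<tau>'. subst_pstep R (vars_at (Fun f ls) (\<Union>i<length ls. (#) i ` P i)) \<tau> \<tau>'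
    \<and> (\<forall>i<length ls. ls ! i \<cdot> \<tau>' = ls ! i \<cdot> \<tau>s i)"
proof -
  obtain \<tau>' where \<tau>': "\<And>i x. i < length ls \<Longrightarrow> x \<in> vars (ls ! i) \<Longrightarrow> \<tau>' x = \<tau>s i x"
    and out: "\<And>x. x \<notin> vars (Fun f ls) \<Longrightarrow> \<tau>' x = \<tau> x"
    using linear_trm_glue_subst[OF assms(1), of \<tau>s \<tau>] by metis
  have "(\<tau> x, \<tau>' x) \<in> pstep R" for x
  proof (cases "x \<in> vars (Fun f ls)")
    case True
    then obtain i where "i < length ls" "x \<in> vars (ls ! i)" by (auto simp: in_set_conv_nth)
    then show ?thesis using steps \<tau>' unfolding subst_pstep_def by metis
  qed (simp add: out)
  moreover have "\<tau> x = \<tau>' x" if x: "x \<in> vars_at (Fun f ls) (\<Union>i<length ls. (#) i ` P i)" for x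
  proof -
    obtain i where i: "i < length ls" "x \<in> vars_at (ls ! i) (P i)"
      using x unfolding vars_at_def by auto
    moreover from this have "x \<in> vars (ls ! i)"
      using P[OF i(1)] vars_subt_at unfolding vars_at_def funposs_def by blast
    ultimately show ?thesis using steps \<tau>' unfolding subst_pstep_def by metis
  qed
  moreover have "ls ! i \<cdot> \<tau>' = ls ! i \<cdot> \<tau>s i" if "i < length ls" for i
    using \<tau>'[OF that] by (rule subst_cong)
  ultimately show ?thesis unfolding subst_pstep_def by blast
qed

lemma pstep_linear_decompose:
  assumes "linear_trm l" "(l \<cdot> \<tau>, t) \<in> pstep R"
  shows "\<exists>P g \<tau>'. overlaps R l \<tau> P g \<and> subst_pstep R (vars_at l P) \<tau> \<tau>' \<and> t = par_repl (l \<cdot> \<tau>') P g"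
  using assms
proof (induction l arbitrary: t)
  case (Var x)
  then show ?case
    by (intro exI[of _ "{}"] exI[of _ "\<lambda>_ :: pos. t"] exI[of _ "\<tau>(x := t)"])
      (auto simp: overlaps_empty vars_at_def subst_pstep_def)
next
  case (Fun f ls)
  from Fun.prems(2) show ?case
  proof (cases rule: pstep.cases)
    case (pstep_Fun ss ts h)
    then have t: "t = Fun f ts" "length ts = length ls"
      and steps: "\<And>i. i < length ls \<Longrightarrow> (ls ! i \<cdot> \<tau>, ts ! i) \<in> pstep R"
      by (auto simp: listrel_iff_nth)
    have "\<exists>P g \<tau>'. overlaps R (ls ! i) \<tau> P g \<and> subst_pstep R (vars_at (ls ! i) P) \<tau> \<tau>'
        \<and> ts ! i = par_repl (ls ! i \<cdot> \<tau>') P g" if "i < length ls" for i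
      using Fun.IH[OF nth_mem[OF that] linear_trm_nth[OF Fun.prems(1) that] steps[OF that]] .
    then obtain P g \<tau>s where ov: "\<And>i. i < length ls \<Longrightarrow> overlaps R (ls ! i) \<tau> (P i) (g i)"
      and \<tau>s: "\<And>i. i < length ls \<Longrightarrow> subst_pstep R (vars_at (ls ! i) (P i)) \<tau> (\<tau>s i)"
      and ts: "\<And>i. i < length ls \<Longrightarrow> ts ! i = par_repl (ls ! i \<cdot> \<tau>s i) (P i) (g i)"
      by metis
    define Q where "Q = (\<Union>i<length ls. (#) i ` P i)"
    have "P i \<subseteq> funposs (ls ! i)" if "i < length ls" for i
      using ov[OF that] unfolding overlaps_def by blast
    then obtain \<tau>' where \<tau>': "subst_pstep R (vars_at (Fun f ls) Q) \<tau> \<tau>'"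
      "\<And>i. i < length ls \<Longrightarrow> ls ! i \<cdot> \<tau>' = ls ! i \<cdot> \<tau>s i"
      using subst_pstep_glue[of f ls P R \<tau> \<tau>s] Fun.prems(1) \<tau>s unfolding Q_def by blast
    have "(#) i -` Q = P i" if "i < length ls" for i using that unfolding Q_def by auto
    then have "t = par_repl (Fun f ls \<cdot> \<tau>') Q (\<lambda>p. g (hd p) (tl p))"
      using ts \<tau>'(2) unfolding t(1) by (auto simp: t(2) Q_def intro!: nth_equalityI)
    with overlaps_Fun[of ls R \<tau> P g f] ov \<tau>'(1) show ?thesis unfolding Q_def by blast
  next
    case pstep_root
    then show ?thesis
      by (intro exI[of _ "{[]}"] exI[of _ "\<lambda>_ :: pos. t"] exI[of _ \<tau>])
        (simp add: overlaps_root subst_pstep_def)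
  qed simp
qed

lemma fresh_renaming:
  assumes "infinite (UNIV :: 'v set)" "finite X" "finite V"
  shows "\<exists>\<pi> :: 'v \<Rightarrow> 'v. bij \<pi> \<and> \<pi> ` X \<inter> V = {}"
proof -
  have "infinite (UNIV - (X \<union> V))" using assms by simp
  then obtain Y where Y: "finite Y" "card Y = card X" "Y \<subseteq> UNIV - (X \<union> V)"
    using infinite_arbitrarily_large by blast
  then obtain h where h: "bij_betw h X Y" using finite_same_card_bij assms(2) by metis
  define \<pi> where "\<pi> x = (if x \<in> X then h x else if x \<in> Y then inv_into X h x else x)" for x
  have "\<pi> (\<pi> x) = x" for x
    using Y(3) h bij_betwE[OF h] bij_betwE[OF bij_betw_inv_into[OF h]]
      bij_betw_inv_into_left[OF h] bij_betw_inv_into_right[OF h]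
    unfolding \<pi>_def by (auto simp: subset_iff)
  then have "bij \<pi>" by (intro o_bij[of \<pi>]) auto
  moreover have "\<pi> ` X \<inter> V = {}" using bij_betwE[OF h] Y(3) unfolding \<pi>_def by auto
  ultimately show ?thesis by blast
qed

lemma vars_rename: "vars (t \<cdot> (Var \<circ> \<pi>)) = \<pi> ` vars t"
  by (auto simp: vars_subst)

lemma finite_vars_rule [simp]: "finite (vars_rule \<rho>)"
  by (simp add: vars_rule_def)

lemma variant_refl: "variant \<rho> \<rho>"
  unfolding variant_def by (auto intro!: exI[of _ id])

lemma rule_subst_cong:
  assumes "\<And>x. x \<in> vars_rule \<rho> \<Longrightarrow> \<sigma> x = \<tau> x"
  shows "fst \<rho> \<cdot> \<sigma> = fst \<rho> \<cdot> \<tau>" "snd \<rho> \<cdot> \<sigma> = snd \<rho> \<cdot> \<tau>"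
  using assms by (auto simp: vars_rule_def intro!: subst_cong)

lemma variant_instance_eq:
  assumes "variant \<rho> (l, r)" "vars r \<subseteq> vars l" "fst \<rho> \<cdot> \<gamma> = l \<cdot> \<tau>"
  shows "snd \<rho> \<cdot> \<gamma> = r \<cdot> \<tau>"
proof -
  obtain \<pi> where \<pi>: "fst \<rho> = l \<cdot> (Var \<circ> \<pi>)" "snd \<rho> = r \<cdot> (Var \<circ> \<pi>)"
    using assms(1) unfolding variant_def by auto
  have "(Var \<circ> \<pi>) x \<cdot> \<gamma> = \<tau> x" if "x \<in> vars l" for x
    using subst_eqD[of l "\<lambda>x. (Var \<circ> \<pi>) x \<cdot> \<gamma>" \<tau>] assms(3) that unfolding \<pi> subst_subst by blast
  then show ?thesis
    unfolding \<pi> subst_subst using assms(2) by (intro subst_cong) auto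
qed

lemma root_step_fresh_variant:
  fixes R :: "('f, 'v) rule set"
  assumes "infinite (UNIV :: 'v set)" "finite V" "(s, t) \<in> root_step R"
  shows "\<exists>\<rho> \<gamma>. (\<exists>\<rho>\<^sub>0\<in>R. variant \<rho> \<rho>\<^sub>0) \<and> vars_rule \<rho> \<inter> V = {} \<and> s = fst \<rho> \<cdot> \<gamma> \<and> t = snd \<rho> \<cdot> \<gamma>"
proof -
  obtain l r \<mu> where "(l, r) \<in> R" and st: "s = l \<cdot> \<mu>" "t = r \<cdot> \<mu>"
    using assms(3) unfolding root_step_iff by blast
  obtain \<pi> where \<pi>: "bij \<pi>" "\<pi> ` vars_rule (l, r) \<inter> V = {}"
    using fresh_renaming[OF assms(1) finite_vars_rule assms(2)] by blast
  let ?\<rho> = "(l \<cdot> (Var \<circ> \<pi>), r \<cdot> (Var \<circ> \<pi>))" and ?\<gamma> = "\<mu> \<circ> inv \<pi>"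
  have "u \<cdot> (Var \<circ> \<pi>) \<cdot> ?\<gamma> = u \<cdot> \<mu>" for u
    using \<pi>(1) by (simp add: subst_subst bij_is_inj)
  moreover have "vars_rule ?\<rho> \<inter> V = {}"
    using \<pi>(2) by (auto simp: vars_rule_def vars_rename)
  moreover have "variant ?\<rho> (l, r)"
    using \<pi>(1) unfolding variant_def by auto
  ultimately show ?thesis using \<open>(l, r) \<in> R\<close> st by (metis fst_conv snd_conv)
qed

definition apart_variants ::
  "('f, 'v) rule set \<Rightarrow> 'v set \<Rightarrow> 'p set \<Rightarrow> ('p \<Rightarrow> ('f, 'v) rule) \<Rightarrow> bool" where
  "apart_variants R V P lr \<longleftrightarrow> (\<forall>p\<in>P. \<exists>\<rho>\<in>R. variant (lr p) \<rho>) \<and> (\<forall>p\<in>P. vars_rule (lr p) \<inter> V = {})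
     \<and> (\<forall>p\<in>P. \<forall>q\<in>P. p \<noteq> q \<longrightarrow> vars_rule (lr p) \<inter> vars_rule (lr q) = {})"

lemma apart_variants_insert:
  assumes "apart_variants R V P lr" "a \<notin> P" "\<rho>\<^sub>0 \<in> R" "variant \<rho> \<rho>\<^sub>0"
    and "vars_rule \<rho> \<inter> (V \<union> (\<Union>p\<in>P. vars_rule (lr p))) = {}"
  shows "apart_variants R V (insert a P) (lr(a := \<rho>))"
  using assms unfolding apart_variants_def by auto

lemma root_steps_apart_variants:
  fixes R :: "('f, 'v) rule set"
  assumes inf: "infinite (UNIV :: 'v set)" and "finite P" "finite V"
    and "\<And>p. p \<in> P \<Longrightarrow> (s p, g p) \<in> root_step R"
  shows "\<exists>lr \<gamma>. apart_variants R V P lr \<and> (\<forall>x\<in>V. \<gamma> x = \<tau> x)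
    \<and> (\<forall>p\<in>P. fst (lr p) \<cdot> \<gamma> = s p \<and> snd (lr p) \<cdot> \<gamma> = g p)"
  using assms(2,4)
proof (induction P)
  case (insert a P)
  then obtain lr \<gamma> where apart: "apart_variants R V P lr" and \<gamma>: "\<forall>x\<in>V. \<gamma> x = \<tau> x"
    and inst: "\<forall>p\<in>P. fst (lr p) \<cdot> \<gamma> = s p \<and> snd (lr p) \<cdot> \<gamma> = g p"
    by blast
  define W where "W = V \<union> (\<Union>p\<in>P. vars_rule (lr p))"
  have "finite W" using \<open>finite V\<close> insert.hyps unfolding W_def by simp
  then obtain \<rho>\<^sub>0 \<rho> \<gamma>\<^sub>a where \<rho>: "\<rho>\<^sub>0 \<in> R" "variant \<rho> \<rho>\<^sub>0" "vars_rule \<rho> \<inter> W = {}"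
    and st: "s a = fst \<rho> \<cdot> \<gamma>\<^sub>a" "g a = snd \<rho> \<cdot> \<gamma>\<^sub>a"
    using root_step_fresh_variant[OF inf _ insert.prems[of a]] by blast
  let ?\<gamma> = "override_on \<gamma>\<^sub>a \<gamma> W"
  have "fst \<rho> \<cdot> ?\<gamma> = s a" "snd \<rho> \<cdot> ?\<gamma> = g a"
    unfolding st by (rule rule_subst_cong; use \<rho>(3) in \<open>auto simp: override_on_def\<close>)+
  moreover have "?\<gamma> x = \<gamma> x" if "p \<in> P" "x \<in> vars_rule (lr p)" for p x
    using that by (auto simp: W_def override_on_def)
  then have "fst (lr p) \<cdot> ?\<gamma> = s p" "snd (lr p) \<cdot> ?\<gamma> = g p" if "p \<in> P" for p
    using rule_subst_cong[of "lr p" ?\<gamma> \<gamma>] inst that by auto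
  moreover have "\<forall>x\<in>V. ?\<gamma> x = \<tau> x" using \<gamma> by (simp add: W_def)
  moreover define lr' where "lr' = lr(a := \<rho>)"
  then have "lr' a = \<rho>" "\<forall>p\<in>P. lr' p = lr p" "apart_variants R V (insert a P) lr'"
    using apart_variants_insert[OF apart insert.hyps(2) \<rho>(1,2) \<rho>(3)[unfolded W_def]] insert.hyps(2)
    by auto
  ultimately show ?case by (intro exI[of _ lr'] exI[of _ ?\<gamma>]) simp
qed (auto simp: apart_variants_def)

definition overlap_eqs ::
  "('f, 'v) trm \<Rightarrow> pos set \<Rightarrow> (pos \<Rightarrow> ('f, 'v) rule) \<Rightarrow> (('f, 'v) trm \<times> ('f, 'v) trm) set" where
  "overlap_eqs l P lr = {(fst (lr p), subt_at l p) | p. p \<in> P}"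

lemma unifier_overlap_eqs:
  "unifier \<sigma> (overlap_eqs l P lr) \<longleftrightarrow> (\<forall>p\<in>P. fst (lr p) \<cdot> \<sigma> = subt_at l p \<cdot> \<sigma>)"
  by (auto simp: unifier_def overlap_eqs_def)

lemma par_crit_peakI:
  assumes "(l, r) \<in> S" and P: "finite P" "P \<noteq> {}" "P \<subseteq> funposs l" "pairwise_par P"
    and "apart_variants R (vars_rule (l, r)) P lr" and "idem_mgu \<sigma> (overlap_eqs l P lr)"
    and "\<not> (P = {[]} \<and> variant (lr []) (l, r))"
  shows "par_crit_peak R S (par_repl (l \<cdot> \<sigma>) P (\<lambda>p. snd (lr p) \<cdot> \<sigma>)) P (l \<cdot> \<sigma>) (r \<cdot> \<sigma>)"
  unfolding par_crit_peak_def par_replace_iff[OF P(4)]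
  using assms variant_refl mgu_if_idem_mgu[of \<sigma>]
  unfolding apart_variants_def overlap_eqs_def by blast

lemma par_repl_subst_idem_mgu:
  assumes "idem_mgu \<sigma> E" "unifier \<gamma> E" "P \<subseteq> poss l"
  shows "par_repl (l \<cdot> \<sigma>) P (\<lambda>p. h p \<cdot> \<sigma>) \<cdot> \<gamma> = par_repl (l \<cdot> \<gamma>) P (\<lambda>p. h p \<cdot> \<gamma>)"
  using assms par_repl_subst[of P "l \<cdot> \<sigma>" "\<lambda>p. h p \<cdot> \<sigma>" \<gamma>] is_pos_subst[of l]
  by (auto simp: poss_def subst_idem_mgu)

lemma unifiers_agree_at_idem_mgu:
  assumes "idem_mgu \<sigma> (overlap_eqs l P lr)"
    and unif: "unifier \<gamma> (overlap_eqs l P lr)" "unifier \<gamma>' (overlap_eqs l P lr)"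
    and "P \<subseteq> poss l" and same: "\<And>p. p \<in> P \<Longrightarrow> fst (lr p) \<cdot> \<gamma> = fst (lr p) \<cdot> \<gamma>'"
    and "x \<in> vars_at (l \<cdot> \<sigma>) P"
  shows "\<gamma> x = \<gamma>' x"
proof -
  obtain p where p: "p \<in> P" "x \<in> vars (subt_at l p \<cdot> \<sigma>)"
    using assms(4,6) subt_at_subst[of l _ \<sigma>] by (auto simp: vars_at_def poss_def)
  then have "subt_at l p \<cdot> \<gamma> = subt_at l p \<cdot> \<gamma>'"
    using unif same unfolding unifier_overlap_eqs by metis
  then have "subt_at l p \<cdot> \<sigma> \<cdot> \<gamma> = subt_at l p \<cdot> \<sigma> \<cdot> \<gamma>'"
    using assms(1-3) by (simp add: subst_idem_mgu)
  then show ?thesis using p(2) by (rule subst_eqD)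
qed

text \<open>With the contracted rules renamed apart, a single substitution \<open>\<gamma>\<close> describes all redexes. The
  substitution step does not touch them, so its target \<open>\<gamma>'\<close> unifies the same equations as \<open>\<gamma>\<close>.\<close>

lemma overlaps_unifiers:
  fixes R :: "('f, 'v) rule set"
  assumes "infinite (UNIV :: 'v set)" "finite V" "vars l \<subseteq> V"
    and ov: "overlaps R l \<tau> P g" and \<tau>': "subst_pstep R (vars_at l P) \<tau> \<tau>'"
  obtains lr \<gamma> \<gamma>' where "apart_variants R V P lr" "subst_pstep R {} \<gamma> \<gamma>'"
    "unifier \<gamma> (overlap_eqs l P lr)" "unifier \<gamma>' (overlap_eqs l P lr)"
    "\<And>u. vars u \<subseteq> V \<Longrightarrow> u \<cdot> \<gamma> = u \<cdot> \<tau>" "\<And>u. vars u \<subseteq> V \<Longrightarrow> u \<cdot> \<gamma>' = u \<cdot> \<tau>'"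
    "\<And>p. p \<in> P \<Longrightarrow> fst (lr p) \<cdot> \<gamma> = fst (lr p) \<cdot> \<gamma>'"
    "\<And>p. p \<in> P \<Longrightarrow> snd (lr p) \<cdot> \<gamma> = g p" "\<And>p. p \<in> P \<Longrightarrow> snd (lr p) \<cdot> \<gamma>' = g p"
proof -
  have "finite P" and pos: "P \<subseteq> poss l"
    and redex: "\<And>p. p \<in> P \<Longrightarrow> (subt_at l p \<cdot> \<tau>, g p) \<in> root_step R"
    using ov unfolding overlaps_def funposs_def poss_def by blast+
  obtain lr \<gamma> where apart: "apart_variants R V P lr" and \<gamma>: "\<And>x. x \<in> V \<Longrightarrow> \<gamma> x = \<tau> x"
    and inst: "\<And>p. p \<in> P \<Longrightarrow> fst (lr p) \<cdot> \<gamma> = subt_at l p \<cdot> \<tau>" "\<And>p. p \<in> P \<Longrightarrow> snd (lr p) \<cdot> \<gamma> = g p"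
    using root_steps_apart_variants[where s = "\<lambda>p. subt_at l p \<cdot> \<tau>" and g = g and \<tau> = \<tau>,
        OF assms(1) \<open>finite P\<close> assms(2) redex] by blast
  define \<gamma>' where "\<gamma>' = override_on \<gamma> \<tau>' V"
  have on_V: "u \<cdot> \<gamma> = u \<cdot> \<tau>" "u \<cdot> \<gamma>' = u \<cdot> \<tau>'" if "vars u \<subseteq> V" for u
    using that by (auto intro!: subst_cong simp: \<gamma> \<gamma>'_def)
  have "\<gamma>' x = \<gamma> x" if "p \<in> P" "x \<in> vars_rule (lr p)" for p x
    using apart that unfolding apart_variants_def \<gamma>'_def by (intro override_on_apply_notin) blast
  then have inst': "fst (lr p) \<cdot> \<gamma>' = fst (lr p) \<cdot> \<gamma>" "snd (lr p) \<cdot> \<gamma>' = snd (lr p) \<cdot> \<gamma>"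
    if "p \<in> P" for p
    using rule_subst_cong[of "lr p" \<gamma>' \<gamma>] that by auto
  have "vars (subt_at l p) \<subseteq> V" "subt_at l p \<cdot> \<tau>' = subt_at l p \<cdot> \<tau>" if "p \<in> P" for p
    using vars_subt_at[of l p] pos assms(3) \<tau>' that
    by (auto intro!: subst_cong simp: poss_def subst_pstep_def vars_at_def)
  then have "unifier \<gamma> (overlap_eqs l P lr)" "unifier \<gamma>' (overlap_eqs l P lr)"
    using inst(1) inst'(1) on_V unfolding unifier_overlap_eqs by simp_all
  moreover have "subst_pstep R {} \<gamma> \<gamma>'"
    using \<tau>' \<gamma> by (auto simp: subst_pstep_def \<gamma>'_def override_on_def)
  ultimately show thesis
    using that[of lr \<gamma> \<gamma>'] apart on_V inst(2) inst' by auto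
qed

lemma overlaps_par_crit_peak:
  fixes R S :: "('f, 'v) rule set"
  assumes "infinite (UNIV :: 'v set)" and S: "(l, r) \<in> S" "vars r \<subseteq> vars l"
    and ov: "overlaps R l \<tau> P g" "P \<noteq> {}" and \<tau>': "subst_pstep R (vars_at l P) \<tau> \<tau>'"
  obtains (same_rule) "par_repl (l \<cdot> \<tau>') P g = r \<cdot> \<tau>"
  | (crit) t\<^sub>0 s\<^sub>0 u\<^sub>0 \<gamma> \<gamma>' where
      "par_crit_peak R S t\<^sub>0 P s\<^sub>0 u\<^sub>0" "subst_pstep R (vars_at s\<^sub>0 P) \<gamma> \<gamma>'"
      "par_repl (l \<cdot> \<tau>') P g = t\<^sub>0 \<cdot> \<gamma>'" "r \<cdot> \<tau> = u\<^sub>0 \<cdot> \<gamma>"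
proof -
  have P: "finite P" "P \<subseteq> funposs l" "pairwise_par P" and pos: "P \<subseteq> poss l"
    using ov(1) unfolding overlaps_def funposs_def poss_def by blast+
  have vars_lr: "vars l \<subseteq> vars_rule (l, r)" "vars r \<subseteq> vars_rule (l, r)"
    by (simp_all add: vars_rule_def)
  obtain lr \<gamma> \<gamma>' where apart: "apart_variants R (vars_rule (l, r)) P lr"
    and step: "subst_pstep R {} \<gamma> \<gamma>'"
    and unif: "unifier \<gamma> (overlap_eqs l P lr)" "unifier \<gamma>' (overlap_eqs l P lr)"
    and inst: "l \<cdot> \<gamma> = l \<cdot> \<tau>" "r \<cdot> \<gamma> = r \<cdot> \<tau>" "l \<cdot> \<gamma>' = l \<cdot> \<tau>'"
    and same: "\<And>p. p \<in> P \<Longrightarrow> fst (lr p) \<cdot> \<gamma> = fst (lr p) \<cdot> \<gamma>'"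
    and g: "\<And>p. p \<in> P \<Longrightarrow> snd (lr p) \<cdot> \<gamma> = g p" "\<And>p. p \<in> P \<Longrightarrow> snd (lr p) \<cdot> \<gamma>' = g p"
    using overlaps_unifiers[OF assms(1) finite_vars_rule vars_lr(1) ov(1) \<tau>'] vars_lr by metis
  obtain \<sigma> where \<sigma>: "idem_mgu \<sigma> (overlap_eqs l P lr)"
    using ex_idem_mgu[OF _ unif(1)] P(1) unfolding overlap_eqs_def by auto
  show thesis
  proof (cases "P = {[]} \<and> variant (lr []) (l, r)")
    case True
    then have "fst (lr []) \<cdot> \<gamma> = l \<cdot> \<tau>"
      using unif(1) inst(1) unfolding unifier_overlap_eqs by simp
    then have "g [] = r \<cdot> \<tau>"
      using variant_instance_eq[OF _ S(2)] g(1) True by auto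
    then show thesis using True same_rule by simp
  next
    case False
    have "par_repl (l \<cdot> \<tau>') P g = par_repl (l \<cdot> \<sigma>) P (\<lambda>p. snd (lr p) \<cdot> \<sigma>) \<cdot> \<gamma>'"
      unfolding par_repl_subst_idem_mgu[OF \<sigma> unif(2) pos] inst(3)
      using g(2) by (auto intro: par_repl_cong)
    moreover have "r \<cdot> \<tau> = r \<cdot> \<sigma> \<cdot> \<gamma>"
      using inst(2) subst_idem_mgu[OF \<sigma> unif(1)] by simp
    moreover have "subst_pstep R (vars_at (l \<cdot> \<sigma>) P) \<gamma> \<gamma>'"
      using step unifiers_agree_at_idem_mgu[OF \<sigma> unif pos same] by (auto simp: subst_pstep_def)
    ultimately show thesis
      using crit par_crit_peakI[OF S(1) P(1) ov(2) P(2,3) apart \<sigma> False] by blast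
  qed
qed

lemma pstep_root_step_peak [consumes 5]:
  fixes R S :: "('f, 'v) rule set"
  assumes "infinite (UNIV :: 'v set)" "trs S" "left_linear S" "(l, r) \<in> S" "(l \<cdot> \<tau>, t) \<in> pstep R"
  obtains (subst) \<tau>' where "t = l \<cdot> \<tau>'" "subst_pstep R {} \<tau> \<tau>'"
  | (same_rule) "t = r \<cdot> \<tau>"
  | (crit) t\<^sub>0 P s\<^sub>0 u\<^sub>0 \<gamma> \<gamma>' where
      "par_crit_peak R S t\<^sub>0 P s\<^sub>0 u\<^sub>0" "subst_pstep R (vars_at s\<^sub>0 P) \<gamma> \<gamma>'"
      "t = t\<^sub>0 \<cdot> \<gamma>'" "r \<cdot> \<tau> = u\<^sub>0 \<cdot> \<gamma>"
proof -
  have S: "linear_trm l" "vars r \<subseteq> vars l"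
    using assms(2-4) unfolding trs_def left_linear_def by blast+
  obtain P g \<tau>' where dec: "overlaps R l \<tau> P g" "subst_pstep R (vars_at l P) \<tau> \<tau>'"
    "t = par_repl (l \<cdot> \<tau>') P g"
    using pstep_linear_decompose[OF S(1) assms(5)] by blast
  show thesis
  proof (cases "P = {}")
    case True
    then show thesis using dec subst by (simp add: vars_at_def)
  next
    case False
    from assms(1,4) S(2) dec(1) False dec(2) show thesis
      by (rule overlaps_par_crit_peak) (use dec(3) same_rule crit in auto)
  qed
qed

section \<open>Labeled parallel steps\<close>

lemma lab_mono: "j \<le> k \<Longrightarrow> lab R \<phi> j \<subseteq> lab R \<phi> k"
  by (auto simp: lab_def)

lemma mono_pstep_lab: "mono (\<lambda>k. pstep (lab R \<phi> k))"
  by (intro monoI pstep_mono lab_mono)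

abbreviation lab_joins :: "('f, 'v) rule set \<Rightarrow> (('f, 'v) rule \<Rightarrow> nat) \<Rightarrow> (('f, 'v) rule \<Rightarrow> nat)
    \<Rightarrow> nat \<Rightarrow> nat \<Rightarrow> ('f, 'v) trm rel" where
  "lab_joins R \<phi> \<psi> \<equiv> decreasing_joins (\<lambda>k. (pstep (lab R \<phi> k))\<inverse>) (\<lambda>m. pstep (lab R \<psi> m))"

lemma rtrancl_conv_lab_subset_conv_below:
  "(conv_lab R \<phi> \<psi> {j. j < k})\<^sup>* \<subseteq> conv_below (\<lambda>k. (pstep (lab R \<phi> k))\<inverse>) (\<lambda>m. pstep (lab R \<psi> m)) k"
  unfolding conv_lab_def below_def
  by (rule rtrancl_mono) (use rstep_subset_pstep in fast)

lemma decreasing_subst: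
  assumes "decreasing R \<phi> \<psi> k m t P s u" "subst_pstep (lab R \<phi> k) (vars_at s P) \<gamma> \<gamma>'"
  shows "(t \<cdot> \<gamma>', u \<cdot> \<gamma>) \<in> lab_joins R \<phi> \<psi> k m"
proof -
  let ?c = "conv_below (\<lambda>k. (pstep (lab R \<phi> k))\<inverse>) (\<lambda>m. pstep (lab R \<psi> m))"
  have max: "{j. j < k} \<union> {j. j < m} = {j. j < max k m}" by auto
  obtain t\<^sub>1 t\<^sub>2 v P' w where "(t, t\<^sub>1) \<in> ?c k"
    "(t\<^sub>1, t\<^sub>2) \<in> pstep (lab R \<psi> m)" "(t\<^sub>2, v) \<in> ?c (max k m)"
    and P': "par_step_at (lab R \<phi> k) P' w v" "vars_at v P' \<subseteq> vars_at s P" and "(w, u) \<in> ?c m"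
    using assms(1) rtrancl_conv_lab_subset_conv_below par_step_subset_pstep
    unfolding decreasing_def max by blast
  moreover have "subst_closed (?c j)" for j
    by (intro subst_closed_below subst_closed_Un subst_closed_converse subst_closed_pstep)
  ultimately have "(t \<cdot> \<gamma>', t\<^sub>1 \<cdot> \<gamma>') \<in> ?c k" "(t\<^sub>1 \<cdot> \<gamma>', t\<^sub>2 \<cdot> \<gamma>') \<in> pstep (lab R \<psi> m)"
    "(t\<^sub>2 \<cdot> \<gamma>', v \<cdot> \<gamma>') \<in> ?c (max k m)" "(w \<cdot> \<gamma>, u \<cdot> \<gamma>) \<in> ?c m"
    using subst_closedD subst_closed_pstep by blast+
  moreover have "(w \<cdot> \<gamma>, v \<cdot> \<gamma>') \<in> pstep (lab R \<phi> k)"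
    using P' assms(2) by (blast intro: par_step_at_subst subst_pstep_subset)
  ultimately show ?thesis unfolding decreasing_joins_def by blast
qed

lemma root_peak_lab_joins:
  fixes R :: "('f, 'v) rule set"
  assumes "infinite (UNIV :: 'v set)" "trs R" "left_linear R"
    and dec: "\<And>t P s u. par_crit_peak (lab R \<phi> k) (lab R \<psi> m) t P s u \<Longrightarrow>
      decreasing R \<phi> \<psi> k m t P s u"
  shows "(pstep (lab R \<phi> k))\<inverse> O root_step (lab R \<psi> m) \<subseteq> lab_joins R \<phi> \<psi> k m"
proof (rule subrelI)
  fix t u assume "(t, u) \<in> (pstep (lab R \<phi> k))\<inverse> O root_step (lab R \<psi> m)"
  then obtain s where "(s, u) \<in> root_step (lab R \<psi> m)" and "(s, t) \<in> pstep (lab R \<phi> k)"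
    by blast
  then obtain l r \<tau> where lr: "(l, r) \<in> lab R \<psi> m" and u: "u = r \<cdot> \<tau>"
    and t: "(l \<cdot> \<tau>, t) \<in> pstep (lab R \<phi> k)"
    unfolding root_step_iff by blast
  have "trs (lab R \<psi> m)" "left_linear (lab R \<psi> m)"
    using assms(2,3) unfolding trs_def left_linear_def lab_def by blast+
  from assms(1) this lr t show "(t, u) \<in> lab_joins R \<phi> \<psi> k m"
  proof (cases rule: pstep_root_step_peak)
    case (subst \<tau>')
    have "(t, r \<cdot> \<tau>') \<in> pstep (lab R \<psi> m)"
      unfolding subst(1) using lr by (intro pstep_root root_stepI)
    moreover have "(u, r \<cdot> \<tau>') \<in> pstep (lab R \<phi> k)"
      unfolding u using subst(2) by (intro pstep_subst) (simp add: subst_pstep_def)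
    ultimately show ?thesis by (auto intro: decreasing_joinsI)
  next
    case same_rule
    then show ?thesis unfolding u by (simp add: decreasing_joinsI[OF pstep_refl])
  next
    case crit
    then show ?thesis unfolding u crit(3,4) by (intro decreasing_subst dec)
  qed
qed

lemma pstep_peak_subset:
  assumes right_root: "(pstep R)\<inverse> O root_step S \<subseteq> D" and left_root: "(root_step R)\<inverse> O pstep S \<subseteq> D"
    and D: "args_closed D" "\<And>x. (Var x, Var x) \<in> D"
  shows "(pstep R)\<inverse> O pstep S \<subseteq> D"
proof -
  have "(t, u) \<in> D" if "(s, t) \<in> pstep R" "(s, u) \<in> pstep S" for s t u
    using that
  proof (induction s arbitrary: t u)
    case (Var x)
    then have "(Var x, t) \<in> root_step R \<or> (Var x, u) \<in> root_step S \<or> t = Var x \<and> u = Var x"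
      by (auto elim!: pstep.cases)
    then show ?case using Var.prems right_root left_root D(2) by blast
  next
    case (Fun f ss)
    consider (left) "(Fun f ss, t) \<in> root_step R" | (right) "(Fun f ss, u) \<in> root_step S"
      | (args) ts us where "t = Fun f ts" "u = Fun f us"
        "(ss, ts) \<in> listrel (pstep R)" "(ss, us) \<in> listrel (pstep S)"
      using Fun.prems by (auto elim!: pstep.cases)
    then show ?case
    proof cases
      case args
      have "(ts ! i, us ! i) \<in> D" if "i < length ss" for i
        using Fun.IH[OF nth_mem[OF that]] args(3,4) that by (simp add: listrel_iff_nth)
      then show ?thesis
        unfolding args(1,2) using args(3,4)
        by (intro args_closedD[OF D(1)]) (simp add: listrel_iff_nth)
    qed (use Fun.prems right_root left_root in blast)+
  qed
  then show ?thesis by blast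
qed

lemma par_peak_lab_joins:
  fixes R :: "('f, 'v) rule set"
  assumes "infinite (UNIV :: 'v set)" "trs R" "left_linear R"
    and "\<And>t P s u. par_crit_peak (lab R \<phi> k) (lab R \<psi> m) t P s u \<Longrightarrow> decreasing R \<phi> \<psi> k m t P s u"
    and "\<And>t P s u. par_crit_peak (lab R \<psi> m) (lab R \<phi> k) t P s u \<Longrightarrow> decreasing R \<psi> \<phi> m k t P s u"
  shows "(pstep (lab R \<phi> k))\<inverse> O pstep (lab R \<psi> m) \<subseteq> lab_joins R \<phi> \<psi> k m"
proof (rule pstep_peak_subset)
  show "(pstep (lab R \<phi> k))\<inverse> O root_step (lab R \<psi> m) \<subseteq> lab_joins R \<phi> \<psi> k m"
    using assms(1-4) by (rule root_peak_lab_joins)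
  have "((pstep (lab R \<psi> m))\<inverse> O root_step (lab R \<phi> k))\<inverse> \<subseteq> (lab_joins R \<psi> \<phi> m k)\<inverse>"
    using root_peak_lab_joins[OF assms(1-3,5)] by simp
  then show "(root_step (lab R \<phi> k))\<inverse> O pstep (lab R \<psi> m) \<subseteq> lab_joins R \<phi> \<psi> k m"
    by (simp add: converse_relcomp converse_decreasing_joins)
  show "args_closed (lab_joins R \<phi> \<psi> k m)"
    by (intro args_closed_decreasing_joins args_closed_converse args_closed_pstep refl_pstep)
      (simp add: refl_pstep)
qed (rule decreasing_joinsI[OF pstep_refl], simp)

lemma commute_iff_church_rosser: "commute R S \<longleftrightarrow> church_rosser ((pstep R)\<inverse>) (pstep S)"
  unfolding commute_def church_rosser_iff_commute by (simp add: rtrancl_converse rtrancl_pstep)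

lemma decreasing_families_pstep_lab:
  fixes R :: "('f, 'v) rule set"
  assumes "infinite (UNIV :: 'v set)" "trs R" "left_linear R" and "commute (lab R \<phi> 0) (lab R \<psi> 0)"
    and "\<And>k m t P s u. (k, m) \<noteq> (0, 0) \<Longrightarrow> par_crit_peak (lab R \<phi> k) (lab R \<psi> m) t P s u \<Longrightarrow>
      decreasing R \<phi> \<psi> k m t P s u"
    and "\<And>k m t P s u. (k, m) \<noteq> (0, 0) \<Longrightarrow> par_crit_peak (lab R \<psi> m) (lab R \<phi> k) t P s u \<Longrightarrow>
      decreasing R \<psi> \<phi> m k t P s u"
  shows "decreasing_families (\<lambda>k. (pstep (lab R \<phi> k))\<inverse>) (\<lambda>m. pstep (lab R \<psi> m))"
proof
  show "mono (\<lambda>k. (pstep (lab R \<phi> k))\<inverse>)"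
    using mono_pstep_lab[of R \<phi>] by (simp add: mono_def)
  show "mono (\<lambda>m. pstep (lab R \<psi> m))"
    by (rule mono_pstep_lab)
  show "church_rosser ((pstep (lab R \<phi> 0))\<inverse>) (pstep (lab R \<psi> 0))"
    using assms(4) by (simp add: commute_iff_church_rosser)
  show "(pstep (lab R \<phi> k))\<inverse> O pstep (lab R \<psi> m) \<subseteq> lab_joins R \<phi> \<psi> k m" if "(k, m) \<noteq> (0, 0)" for k m
    using assms(1-3,5,6) that by (intro par_peak_lab_joins) blast+
qed

lemma rtrancl_rstep_iff_lab: "(s, t) \<in> (rstep R)\<^sup>* \<longleftrightarrow> (\<exists>n. (s, t) \<in> (rstep (lab R \<phi> n))\<^sup>*)"
proof -
  have "rstep R = (\<Union>n. rstep (lab R \<phi> n))"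
    unfolding rstep_def lab_def by blast
  moreover have "mono (\<lambda>n. rstep (lab R \<phi> n))"
    unfolding mono_def rstep_def using lab_mono by blast
  ultimately show ?thesis by (simp add: rtrancl_UN_mono)
qed

lemma rtrancl_rstep_lab_mono: "j \<le> k \<Longrightarrow> (rstep (lab R \<phi> j))\<^sup>* \<subseteq> (rstep (lab R \<phi> k))\<^sup>*"
  unfolding rtrancl_pstep[symmetric] by (intro rtrancl_mono pstep_mono lab_mono)

lemma confluent_if_commute_lab:
  assumes "\<And>n. commute (lab R \<phi> n) (lab R \<psi> n)"
  shows "confluent R"
  unfolding confluent_def commute_def
proof (rule subrelI)
  fix t u assume "(t, u) \<in> ((rstep R)\<inverse>)\<^sup>* O (rstep R)\<^sup>*"
  then obtain s where "(s, t) \<in> (rstep R)\<^sup>*" "(s, u) \<in> (rstep R)\<^sup>*"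
    unfolding rtrancl_converse by blast
  then obtain k m where "(s, t) \<in> (rstep (lab R \<phi> k))\<^sup>*" "(s, u) \<in> (rstep (lab R \<psi> m))\<^sup>*"
    using rtrancl_rstep_iff_lab by metis
  then have "(s, t) \<in> (rstep (lab R \<phi> (max k m)))\<^sup>*" "(s, u) \<in> (rstep (lab R \<psi> (max k m)))\<^sup>*"
    using rtrancl_rstep_lab_mono[of _ "max k m"] by (meson max.cobounded1 max.cobounded2 subsetD)+
  then obtain v where "(t, v) \<in> (rstep (lab R \<psi> (max k m)))\<^sup>*"
    "(u, v) \<in> (rstep (lab R \<phi> (max k m)))\<^sup>*"
    using assms[of "max k m"] unfolding commute_def rtrancl_converse by blast
  then have "(t, v) \<in> (rstep R)\<^sup>*" "(u, v) \<in> (rstep R)\<^sup>*"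
    using rtrancl_rstep_iff_lab by metis+
  then show "(t, u) \<in> (rstep R)\<^sup>* O ((rstep R)\<inverse>)\<^sup>*" unfolding rtrancl_converse by blast
qed

theorem theorem9:
  fixes R :: "('f, 'v) rule set" and \<phi> \<psi> :: "('f, 'v) rule \<Rightarrow> nat"
  assumes "infinite (UNIV :: 'v set)"
    and "trs R"
    and "left_linear R"
    and "commute (lab R \<phi> 0) (lab R \<psi> 0)"
    and "\<forall>k m. (k, m) \<noteq> (0, 0) \<longrightarrow>
           (\<forall>t P s u. par_crit_peak (lab R \<phi> k) (lab R \<psi> m) t P s u
                        \<longrightarrow> decreasing R \<phi> \<psi> k m t P s u)
         \<and> (\<forall>t P s u. par_crit_peak (lab R \<psi> m) (lab R \<phi> k) t P s u
                        \<longrightarrow> decreasing R \<psi> \<phi> m k t P s u)"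
  shows "confluent R"
proof (rule confluent_if_commute_lab)
  fix n
  have "decreasing_families (\<lambda>k. (pstep (lab R \<phi> k))\<inverse>) (\<lambda>m. pstep (lab R \<psi> m))"
    using assms(1-4) by (rule decreasing_families_pstep_lab) (use assms(5) in blast)+
  then show "commute (lab R \<phi> n) (lab R \<psi> n)"
    unfolding commute_iff_church_rosser by (rule decreasing_families.church_rosser)
qed

end
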